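(* Let $\{c(r): r\in\mathbb{Z}\}$ be a real symmetric, positive definite sequence whose Fourier transform $f(\omega)=\sum_{r\in\mathbb{Z}}c(r)e^{ir\omega}$ satisfies $0<\inf_\omega f(\omega)\le\sup_\omega f(\omega)<\infty$. Let $\sigma^2$, $\phi_j$, $\phi(\cdot)$, $\psi(\cdot)$ be the quantities in the spectral factorization of $f$ described in the context, and for $k\ge0$ let $\phi_k(\omega)=\sum_{s=1}^{\infty}\phi_{k+s}e^{is\omega}$. Write $T(f)^{-1}=(d_{k,j};k,j\ge0)$ for the inverse on $\ell_2^+$ of the semi-infinite Toeplitz operator $T(f)=(c(t-\tau);t,\tau\ge0)$, and let ${\bf d}_k=(d_{k,j};j\ge0)$ denote its $k$th row. Then ${\bf d}_k'\in\ell_2^+$ for all $k\ge0$, and the Fourier transform $D_k(\omega)=\sum_{j=0}^{\infty}d_{k,j}e^{ij\omega}$ is $$D_k(\omega)=\frac{e^{ik\omega}+\psi(\omega)^*\phi_k(\omega)^*}{f(\omega)}=\sigma^{-2}\phi(\omega)\Big(e^{ik\omega}-\sum_{s=1}^{k}\phi_se^{i(k-s)\omega}\Big),\qquad k\ge0.$$ Therefore, $$d_{k,j}=\frac{\sigma^{-2}}{2\pi}\int_0^{2\pi}\phi(\omega)\Big(e^{ik\omega}-\sum_{s=1}^{k}\phi_se^{i(k-s)\omega}\Big)e^{-ij\omega}\,d\omega,\qquad j,k\ge0.$$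
   Context: $\ell_2^+$ is the space of square-summable sequences $(v_0,v_1,\ldots)'$. It is well known that $T(f)$ is a bounded invertible operator on $\ell_2^+$ when $0<\inf_\omega f\le\sup_\omega f<\infty$. The superscript $*$ denotes complex conjugation, and $\sum_{s=1}^{0}=0$. Spectral factorization: if $0<\inf_\omega f\le\sup_\omega f<\infty$, there are unique $\sigma^2>0$ and real square-summable sequences $(\psi_j)_{j\ge1}$, $(\phi_j)_{j\ge1}$ such that $\Psi(z)=1+\sum_{j\ge1}\psi_jz^j$ and $\Phi(z)=1-\sum_{j\ge1}\phi_jz^j$ satisfy $\Psi(z)\Phi(z)=1$ for $|z|<1$, and, with $\psi(\omega)=1+\sum_{j\ge1}\psi_je^{ij\omega}$ and $\phi(\omega)=1-\sum_{j\ge1}\phi_je^{ij\omega}=\psi(\omega)^{-1}$, one has $f(\omega)=\sigma^2|\psi(\omega)|^2=\sigma^2|\phi(\omega)|^{-2}$. Fourier series with square-summable coefficients are understood as elements of $L_2([0,2\pi))$, and identities between functions of $\omega$ are identities in $L_2([0,2\pi))$ (i.e. for almost every $\omega$). *)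

theory Defs
  imports "HOL-Analysis.Analysis" "HOL-Probability.Essential_Supremum"
begin

text \<open>
  Elements of \<open>L\<^sub>2([0,2\<pi>))\<close> are represented by functions on the reals; only their values almost
  everywhere on \<open>[0,2\<pi>)\<close> matter.
\<close>

abbreviation circ :: "real measure"
  where "circ \<equiv> lebesgue_on {0..<2*pi}"

definition square_integrable :: "'a measure \<Rightarrow> ('a \<Rightarrow> complex) \<Rightarrow> bool"
  where "square_integrable M g \<longleftrightarrow>
    g \<in> borel_measurable M \<and> integrable M (\<lambda>x. (cmod (g x))\<^sup>2)"

text \<open>
  \<open>fourier_series_L2 a g\<close>: the series \<open>\<Sum>\<^sub>r a(r) e\<^sup>i\<^sup>r\<^sup>\<omega>\<close> over all integers converges to \<open>g\<close> in
  \<open>L\<^sub>2([0,2\<pi>))\<close>. This determines \<open>g\<close> up to a null set and forces \<open>a\<close> to be square-summable.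
\<close>

definition fourier_series_L2 :: "(int \<Rightarrow> complex) \<Rightarrow> (real \<Rightarrow> complex) \<Rightarrow> bool"
  where "fourier_series_L2 a g \<longleftrightarrow> square_integrable circ g \<and>
    (\<lambda>n. LINT \<omega>|circ. (cmod ((\<Sum>r = - int n..int n. a r * cis (of_int r * \<omega>)) - g \<omega>))\<^sup>2)
      \<longlonglongrightarrow> 0"

definition one_sided :: "(nat \<Rightarrow> complex) \<Rightarrow> int \<Rightarrow> complex"
  where "one_sided a r = (if 0 \<le> r then a (nat r) else 0)"

definition essinf :: "'a measure \<Rightarrow> ('a \<Rightarrow> ereal) \<Rightarrow> ereal"
  where "essinf M f = - esssup M (\<lambda>x. - f x)"

text \<open>
  Positive definiteness of a real symmetric sequence in the sense of the Herglotz theorem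
  (non-negative quadratic forms). When the Fourier transform is bounded away from zero, the forms
  are automatically strictly positive, so this agrees with the strict convention there.
\<close>

definition positive_definite_seq :: "(int \<Rightarrow> real) \<Rightarrow> bool"
  where "positive_definite_seq c \<longleftrightarrow>
    (\<forall>n (x :: nat \<Rightarrow> real). 0 \<le> (\<Sum>s<n. \<Sum>t<n. x s * c (int s - int t) * x t))"

text \<open>
  The values \<open>\<psi> 0\<close> and \<open>\<phi> 0\<close> are never used: the sequences are indexed from \<open>1\<close>. The functions
  \<open>\<psi>F\<close> and \<open>\<phi>F\<close> are the boundary functions \<open>\<psi>(\<omega>)\<close> and \<open>\<phi>(\<omega>)\<close>.
\<close>

definition spectral_factorization ::
    "(real \<Rightarrow> real) \<Rightarrow> real \<Rightarrow> (nat \<Rightarrow> real) \<Rightarrow> (nat \<Rightarrow> real) \<Rightarrow>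
     (real \<Rightarrow> complex) \<Rightarrow> (real \<Rightarrow> complex) \<Rightarrow> bool"
  where "spectral_factorization f \<sigma>2 \<psi> \<phi> \<psi>F \<phi>F \<longleftrightarrow>
    \<sigma>2 > 0 \<and>
    summable (\<lambda>j. (\<psi> (Suc j))\<^sup>2) \<and>
    summable (\<lambda>j. (\<phi> (Suc j))\<^sup>2) \<and>
    (\<forall>z :: complex. cmod z < 1 \<longrightarrow>
       (1 + (\<Sum>j. of_real (\<psi> (Suc j)) * z ^ Suc j)) *
       (1 - (\<Sum>j. of_real (\<phi> (Suc j)) * z ^ Suc j)) = 1) \<and>
    fourier_series_L2 (one_sided (\<lambda>j. if j = 0 then 1 else of_real (\<psi> j))) \<psi>F \<and>
    fourier_series_L2 (one_sided (\<lambda>j. if j = 0 then 1 else - of_real (\<phi> j))) \<phi>F \<and>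
    (AE \<omega> in circ. \<phi>F \<omega> = inverse (\<psi>F \<omega>)) \<and>
    (AE \<omega> in circ. f \<omega> = \<sigma>2 * (cmod (\<psi>F \<omega>))\<^sup>2) \<and>
    (AE \<omega> in circ. f \<omega> = \<sigma>2 / (cmod (\<phi>F \<omega>))\<^sup>2)"

definition ell2 :: "(nat \<Rightarrow> complex) set"
  where "ell2 = {v. summable (\<lambda>n. (cmod (v n))\<^sup>2)}"

definition toeplitz :: "(int \<Rightarrow> real) \<Rightarrow> (nat \<Rightarrow> complex) \<Rightarrow> nat \<Rightarrow> complex"
  where "toeplitz c v t = (\<Sum>\<tau>. of_real (c (int t - int \<tau>)) * v \<tau>)"

definition unit_seq :: "nat \<Rightarrow> nat \<Rightarrow> complex"
  where "unit_seq j i = (if i = j then 1 else 0)"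

text \<open>
  The \<open>(k, j)\<close> entry of the matrix of the inverse operator on \<open>\<ell>\<^sub>2\<^sup>+\<close>. The operator is a bijection of
  \<open>ell2\<close> whenever the Fourier transform of \<open>c\<close> is essentially bounded away from \<open>0\<close> and \<open>\<infinity>\<close>.
\<close>

definition toeplitz_inv :: "(int \<Rightarrow> real) \<Rightarrow> nat \<Rightarrow> nat \<Rightarrow> complex"
  where "toeplitz_inv c k j = the_inv_into ell2 (toeplitz c) (unit_seq j) k"

end

theory Submission
  imports Defs
begin

text \<open>
  Write \<open>a\<^sub>j\<close> and \<open>b\<^sub>j\<close> for the coefficients of \<open>\<psi>\<close> and \<open>\<phi>\<close>, with \<open>a\<^sub>0 = b\<^sub>0 = 1\<close>. Multiplying
  \<open>D = \<sigma>\<^sup>-\<^sup>2 \<phi> p\<^sub>k\<close>, where \<open>p\<^sub>k\<close> is the non-negative-frequency part of \<open>e\<^sup>i\<^sup>k\<^sup>\<omega> \<phi>\<^sup>*\<close>, by \<open>f = \<sigma>\<^sup>2 \<psi> \<psi>\<^sup>*\<close> leaves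
  \<open>\<psi>\<^sup>* p\<^sub>k\<close>, which differs from \<open>e\<^sup>i\<^sup>k\<^sup>\<omega>\<close> by negative frequencies only; so the coefficient sequence of
  \<open>D\<close> solves \<open>T(f) v = e\<^sub>k\<close>. This describes the columns of the inverse, and the resulting matrix is
  symmetric. Injectivity of \<open>T(f)\<close> on \<open>\<ell>\<^sub>2\<^sup>+\<close> comes from coercivity of the quadratic form
  \<open>\<integral> f \<bar>V\<bar>\<^sup>2\<close> on trigonometric polynomials, and truncation.
\<close>

subsection \<open>Fourier series in \<open>L\<^sub>2\<close>\<close>

abbreviation expi :: "int \<Rightarrow> real \<Rightarrow> complex"
  where "expi r \<omega> \<equiv> cis (of_int r * \<omega>)"

lemma finite_measure_circ: "finite_measure circ"
  by (rule finite_measure_lebesgue_on) (auto intro!: bounded_set_imp_lmeasurable)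

lemma cis_measurable_circ [measurable]: "(\<lambda>\<omega>. cis (a * \<omega>)) \<in> borel_measurable circ"
  by (intro continuous_imp_measurable_on_sets_lebesgue continuous_intros) auto

lemma integrable_const_circ: "integrable circ (\<lambda>_. c)"
  using finite_measure.integrable_const[OF finite_measure_circ] .

lemma integrable_bounded_circ:
  fixes g :: "real \<Rightarrow> complex"
  assumes "g \<in> borel_measurable circ" "\<And>x. cmod (g x) \<le> B"
  shows "integrable circ g"
  using finite_measure.integrable_const_bound[OF finite_measure_circ _ assms(1), of B] assms(2) by simp

text \<open>Orthogonality of the exponentials: for \<open>r \<noteq> 0\<close> the antiderivative
  \<open>expi r \<omega> / (\<i> * of_int r)\<close> takes the same value at both ends of the
  period.\<close>

lemma integral_expi:
  "(LINT \<omega>|circ. expi r \<omega>) = (if r = 0 then of_real (2*pi) else 0)"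
proof -
  have int: "integrable circ (expi r)"
    by (rule integrable_bounded_circ[where B = 1]) auto
  have "(LINT \<omega>|circ. expi r \<omega>) = integral {0..<2*pi} (expi r)"
    by (rule lebesgue_integral_eq_integral[OF int]) simp
  \<comment> \<open>The fundamental theorem of calculus is applied on a closed interval; the added
    endpoint \<open>2*pi\<close> is negligible.\<close>
  also have "\<dots> = integral {0..2*pi} (expi r)"
  proof (rule integral_spike_set)
    show "negligible {x \<in> {0..<2*pi} - {0..2*pi}. expi r x \<noteq> 0}"
      by (rule negligible_subset[of "{}"]) auto
    show "negligible {x \<in> {0..2*pi} - {0..<2*pi}. expi r x \<noteq> 0}"
      by (rule negligible_subset[of "{2*pi}"]) auto
  qed
  also have "\<dots> = (if r = 0 then of_real (2*pi) else 0)"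
  proof (cases "r = 0")
    case False
    have "((expi r) has_integral
        (expi r (2*pi) / (\<i> * of_int r) - expi r 0 / (\<i> * of_int r))) {0..2*pi}"
    proof (rule fundamental_theorem_of_calculus)
      fix x assume "x \<in> {0..2*pi}"
      show "((\<lambda>\<omega>. expi r \<omega> / (\<i> * of_int r)) has_vector_derivative expi r x)
          (at x within {0..2*pi})"
        unfolding has_vector_derivative_def using False
        by (auto intro!: derivative_eq_intros simp: field_simps scaleR_conv_of_real)
    qed auto
    moreover have "expi r (2*pi) = 1"
      using cis_multiple_2pi[of "of_int r"] by (simp add: mult.commute)
    ultimately show ?thesis
      using False by (simp add: integral_unique)
  qed (simp add: scaleR_conv_of_real)
  finally show ?thesis .
qed

section \<open>Square-integrable functions and products of two of them\<close>

lemma square_integrable_dominated: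
  assumes "square_integrable M g" "h \<in> borel_measurable M" "AE x in M. cmod (h x) \<le> C * cmod (g x)"
  shows "square_integrable M h"
proof -
  have [measurable]: "g \<in> borel_measurable M" "h \<in> borel_measurable M"
    using assms by (auto simp: square_integrable_def)
  have "integrable M (\<lambda>x. C\<^sup>2 * (cmod (g x))\<^sup>2)"
    using assms(1) by (simp add: square_integrable_def)
  then have "integrable M (\<lambda>x. (cmod (h x))\<^sup>2)"
  proof (rule Bochner_Integration.integrable_bound)
    show "AE x in M. norm ((cmod (h x))\<^sup>2) \<le> norm (C\<^sup>2 * (cmod (g x))\<^sup>2)"
      using assms(3)
      by eventually_elim (auto simp flip: power_mult_distrib intro!: power_mono)
  qed simp
  then show ?thesis
    by (simp add: square_integrable_def)
qed

text \<open>Stands in for the triangle inequality of the L2 norm. The factor 2 is harmless, since it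
  only serves boundedness, integrability, summability and convergence to zero.\<close>

lemma norm_add_square_le: "(cmod (a + b))\<^sup>2 \<le> 2 * (cmod a)\<^sup>2 + 2 * (cmod b)\<^sup>2"
proof -
  have "(cmod (a + b))\<^sup>2 \<le> (cmod a + cmod b)\<^sup>2"
    by (intro power_mono norm_triangle_ineq) auto
  also have "\<dots> \<le> 2 * (cmod a)\<^sup>2 + 2 * (cmod b)\<^sup>2"
    using sum_squares_bound[of "cmod a" "cmod b"] by (simp add: power2_sum)
  finally show ?thesis .
qed

lemma square_integrable_add:
  assumes "square_integrable M g" "square_integrable M h"
  shows "square_integrable M (\<lambda>x. g x + h x)"
proof -
  have [measurable]: "g \<in> borel_measurable M" "h \<in> borel_measurable M"
    using assms by (auto simp: square_integrable_def)
  have "integrable M (\<lambda>x. 2 * (cmod (g x))\<^sup>2 + 2 * (cmod (h x))\<^sup>2)"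
    using assms by (simp add: square_integrable_def)
  then have "integrable M (\<lambda>x. (cmod (g x + h x))\<^sup>2)"
    by (rule Bochner_Integration.integrable_bound)
       (use norm_add_square_le in \<open>auto intro!: AE_I2\<close>)
  then show ?thesis
    by (simp add: square_integrable_def)
qed

lemma square_integrable_cmult:
  assumes "square_integrable M g"
  shows "square_integrable M (\<lambda>x. c * g x)"
  by (rule square_integrable_dominated[OF assms, where C = "cmod c"])
     (use assms in \<open>auto simp: square_integrable_def norm_mult\<close>)

lemma square_integrable_diff:
  assumes "square_integrable M g" "square_integrable M h"
  shows "square_integrable M (\<lambda>x. g x - h x)"
  using square_integrable_add[OF assms(1) square_integrable_cmult[OF assms(2), of "-1"]] by simp

lemma square_integrable_sum:
  assumes "finite I" "\<And>i. i \<in> I \<Longrightarrow> square_integrable M (g i)"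
  shows "square_integrable M (\<lambda>x. \<Sum>i\<in>I. g i x)"
  using assms
proof (induction I rule: finite_induct)
  case empty
  then show ?case by (simp add: square_integrable_def)
next
  case (insert i I)
  then show ?case by (auto intro!: square_integrable_add)
qed

lemma square_integrable_cnj:
  assumes "square_integrable M g"
  shows "square_integrable M (\<lambda>x. cnj (g x))"
proof (rule square_integrable_dominated[OF assms, where C = 1])
  show "(\<lambda>x. cnj (g x)) \<in> borel_measurable M"
    by (rule borel_measurable_continuous_on[where f = cnj])
       (use assms in \<open>auto simp: square_integrable_def intro!: continuous_intros\<close>)
qed simp

lemma square_integrable_expi: "square_integrable circ (expi r)"
  by (auto simp: square_integrable_def integrable_const_circ)

lemma square_integrable_times_expi:
  assumes "square_integrable circ g"
  shows "square_integrable circ (\<lambda>x. g x * expi r x)"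
  by (rule square_integrable_dominated[OF assms, where C = 1])
     (use assms in \<open>auto simp: square_integrable_def norm_mult\<close>)

lemma integrable_mult_square_integrable:
  assumes "square_integrable M g" "square_integrable M h"
  shows "integrable M (\<lambda>x. g x * h x)"
proof -
  have [measurable]: "g \<in> borel_measurable M" "h \<in> borel_measurable M"
    using assms by (auto simp: square_integrable_def)
  have "integrable M (\<lambda>x. (cmod (g x))\<^sup>2 + (cmod (h x))\<^sup>2)"
    using assms by (simp add: square_integrable_def)
  then show ?thesis
  proof (rule Bochner_Integration.integrable_bound)
    have "cmod (g x * h x) \<le> (cmod (g x))\<^sup>2 + (cmod (h x))\<^sup>2" for x
      using sum_squares_bound[of "cmod (g x)" "cmod (h x)"]
        mult_nonneg_nonneg[OF norm_ge_zero[of "g x"] norm_ge_zero[of "h x"]]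
      unfolding norm_mult mult.assoc by linarith
    then show "AE x in M. norm (g x * h x) \<le> norm ((cmod (g x))\<^sup>2 + (cmod (h x))\<^sup>2)"
      by (auto intro!: AE_I2)
  qed simp
qed

lemma integrable_square_integrable_circ:
  assumes "square_integrable circ g"
  shows "integrable circ g"
  using integrable_mult_square_integrable[OF assms square_integrable_expi[of 0]] by simp

text \<open>Cauchy-Schwarz without square roots: the pointwise weighted inequality between
  \<open>|g h|\<close>, \<open>|g|^2 / \<epsilon>\<close> and \<open>\<epsilon> |h|^2\<close> is
  integrated. The free weight \<open>\<epsilon>\<close> makes the integral small whenever
  \<open>g\<close> is small in L2.\<close>

lemma norm_integral_mult_le:
  assumes "square_integrable M g" "square_integrable M h" "\<epsilon> > 0"
  shows "cmod (LINT x|M. g x * h x) \<le>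
    ((LINT x|M. (cmod (g x))\<^sup>2) / \<epsilon> + \<epsilon> * (LINT x|M. (cmod (h x))\<^sup>2)) / 2"
proof -
  have ig: "integrable M (\<lambda>x. (cmod (g x))\<^sup>2)" and ih: "integrable M (\<lambda>x. (cmod (h x))\<^sup>2)"
    using assms by (auto simp: square_integrable_def)
  have "cmod (LINT x|M. g x * h x) \<le> (LINT x|M. cmod (g x * h x))"
    by (rule integral_norm_bound)
  also have "\<dots> \<le> (LINT x|M. ((cmod (g x))\<^sup>2 / \<epsilon> + \<epsilon> * (cmod (h x))\<^sup>2) / 2)"
  proof (rule integral_mono)
    show "integrable M (\<lambda>x. cmod (g x * h x))"
      using integrable_mult_square_integrable[OF assms(1,2)] by (rule integrable_norm)
    show "integrable M (\<lambda>x. ((cmod (g x))\<^sup>2 / \<epsilon> + \<epsilon> * (cmod (h x))\<^sup>2) / 2)"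
      using ig ih by auto
    fix x
    have "0 \<le> (cmod (g x) - \<epsilon> * cmod (h x))\<^sup>2 / \<epsilon>"
      using assms(3) by simp
    also have "\<dots> = (cmod (g x))\<^sup>2 / \<epsilon> + \<epsilon> * (cmod (h x))\<^sup>2 - 2 * (cmod (g x) * cmod (h x))"
      using assms(3) by (simp add: field_simps power2_eq_square)
    finally show "cmod (g x * h x) \<le> ((cmod (g x))\<^sup>2 / \<epsilon> + \<epsilon> * (cmod (h x))\<^sup>2) / 2"
      by (simp add: norm_mult)
  qed
  also have "\<dots> = ((LINT x|M. (cmod (g x))\<^sup>2) / \<epsilon> + \<epsilon> * (LINT x|M. (cmod (h x))\<^sup>2)) / 2"
    using ig ih by simp
  finally show ?thesis .
qed

section \<open>What L2 convergence gives: coefficients, Parseval, uniqueness\<close>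

text \<open>The frequency set is arbitrary, so that one Parseval identity serves both symmetric
  windows and blocks of a truncated one-sided sequence.\<close>

definition trig_sum :: "(int \<Rightarrow> complex) \<Rightarrow> int set \<Rightarrow> real \<Rightarrow> complex"
  where "trig_sum a I \<omega> = (\<Sum>r\<in>I. a r * expi r \<omega>)"

lemma fourier_series_L2_iff:
  "fourier_series_L2 a g \<longleftrightarrow> square_integrable circ g \<and>
    (\<lambda>n. LINT \<omega>|circ. (cmod (trig_sum a {- int n..int n} \<omega> - g \<omega>))\<^sup>2) \<longlonglongrightarrow> 0"
  by (simp add: fourier_series_L2_def trig_sum_def)

lemma square_integrable_trig_sum:
  assumes "finite I"
  shows "square_integrable circ (trig_sum a I)"
  unfolding trig_sum_def
  by (intro square_integrable_sum assms square_integrable_cmult square_integrable_expi)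

text \<open>Convergence in L2 implies weak convergence, so the series may be integrated term by term
  against a square-integrable \<open>h\<close>. The coefficient formulas below come from this with
  suitable \<open>h\<close>.\<close>

lemma fourier_series_L2_integral_mult:
  assumes "fourier_series_L2 a g" "square_integrable circ h"
  shows "(\<lambda>n. \<Sum>r=-int n..int n. a r * (LINT \<omega>|circ. expi r \<omega> * h \<omega>))
    \<longlonglongrightarrow> (LINT \<omega>|circ. g \<omega> * h \<omega>)"
proof -
  let ?S = "\<lambda>n. trig_sum a {- int n..int n}"
  let ?d = "\<lambda>n. LINT \<omega>|circ. (cmod (?S n \<omega> - g \<omega>))\<^sup>2"
  let ?H = "LINT \<omega>|circ. (cmod (h \<omega>))\<^sup>2"
  have g: "square_integrable circ g" and d: "?d \<longlonglongrightarrow> 0"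
    using assms(1) by (auto simp: fourier_series_L2_iff)
  have S: "square_integrable circ (?S n)" for n
    by (rule square_integrable_trig_sum) simp
  have H: "?H \<ge> 0"
    by simp
  have eq: "(\<Sum>r=-int n..int n. a r * (LINT \<omega>|circ. expi r \<omega> * h \<omega>)) =
      (LINT \<omega>|circ. ?S n \<omega> * h \<omega>)" for n
  proof -
    have "integrable circ (\<lambda>\<omega>. expi r \<omega> * h \<omega>)" for r
      by (intro integrable_mult_square_integrable square_integrable_expi assms)
    then show ?thesis
      by (simp add: trig_sum_def sum_distrib_right mult.assoc)
  qed
  have diff: "(LINT \<omega>|circ. ?S n \<omega> * h \<omega>) - (LINT \<omega>|circ. g \<omega> * h \<omega>) =
      (LINT \<omega>|circ. (?S n \<omega> - g \<omega>) * h \<omega>)" for n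
    using integrable_mult_square_integrable[OF S[of n] assms(2)]
      integrable_mult_square_integrable[OF g assms(2)]
    by (simp add: left_diff_distrib)
  show ?thesis
    unfolding eq
  proof (rule LIMSEQ_I)
    fix e :: real assume e: "e > 0"
    \<comment> \<open>Balances the two halves of the bound: the weighted norm of \<open>h\<close>
      contributes at most \<open>e\<close>, and \<open>?d n\<close> is eventually below
      \<open>\<epsilon> * e\<close>. The \<open>+ 1\<close> keeps the quotient meaningful when
      \<open>?H = 0\<close>.\<close>
    define \<epsilon> where "\<epsilon> = e / (?H + 1)"
    have "?H + 1 > 0"
      using H by linarith
    then have \<epsilon>: "\<epsilon> > 0" and \<epsilon>H: "\<epsilon> * ?H \<le> e"
      using e by (simp_all add: \<epsilon>_def pos_divide_le_eq distrib_left)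
    have "\<epsilon> * e > 0"
      using \<epsilon> e by simp
    then have "eventually (\<lambda>n. ?d n < \<epsilon> * e) sequentially"
      using order_tendstoD(2)[OF d] by blast
    then obtain N where N: "\<And>n. n \<ge> N \<Longrightarrow> ?d n < \<epsilon> * e"
      by (auto simp: eventually_sequentially)
    have "norm ((LINT \<omega>|circ. ?S n \<omega> * h \<omega>) - (LINT \<omega>|circ. g \<omega> * h \<omega>)) < e" if "n \<ge> N" for n
    proof -
      have "?d n / \<epsilon> < e"
        using N[OF that] \<epsilon> by (simp add: field_simps)
      moreover have "(x + y) / 2 < e" if "x < e" "y \<le> e" for x y :: real
        using that by simp
      ultimately have "(?d n / \<epsilon> + \<epsilon> * ?H) / 2 < e"
        using \<epsilon>H by blast
      with norm_integral_mult_le[OF square_integrable_diff[OF S[of n] g] assms(2) \<epsilon>]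
      show ?thesis
        unfolding diff by (rule order.strict_trans1)
    qed
    then show "\<exists>N. \<forall>n\<ge>N. norm ((LINT \<omega>|circ. ?S n \<omega> * h \<omega>) - (LINT \<omega>|circ. g \<omega> * h \<omega>)) < e"
      by blast
  qed
qed

text \<open>By orthogonality only the term \<open>r = s\<close> survives the test function, so the
  partial sums are constant once the window contains \<open>s\<close>.\<close>

lemma fourier_coefficient:
  assumes "fourier_series_L2 a g"
  shows "(LINT \<omega>|circ. g \<omega> * expi (- s) \<omega>) = of_real (2*pi) * a s"
proof -
  have "(\<lambda>n. \<Sum>r=-int n..int n. a r * (LINT \<omega>|circ. expi r \<omega> * expi (- s) \<omega>)) \<longlonglongrightarrow>
      (LINT \<omega>|circ. g \<omega> * expi (- s) \<omega>)"
    by (rule fourier_series_L2_integral_mult[OF assms square_integrable_expi])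
  moreover have "eventually (\<lambda>n. (\<Sum>r=-int n..int n. a r * (LINT \<omega>|circ. expi r \<omega> * expi (- s) \<omega>)) =
      of_real (2*pi) * a s) sequentially"
  proof (rule eventually_sequentiallyI)
    fix n assume n: "nat \<bar>s\<bar> \<le> n"
    have "(LINT \<omega>|circ. expi r \<omega> * expi (- s) \<omega>) = (if r = s then of_real (2*pi) else 0)" for r
      using integral_expi[of "r - s"] by (simp add: cis_mult algebra_simps)
    then show "(\<Sum>r=-int n..int n. a r * (LINT \<omega>|circ. expi r \<omega> * expi (- s) \<omega>)) =
        of_real (2*pi) * a s"
      using n by (auto simp: if_distrib[of "\<lambda>x. _ * x"] cong: if_cong)
  qed
  ultimately have "(\<lambda>_. of_real (2*pi) * a s) \<longlonglongrightarrow> (LINT \<omega>|circ. g \<omega> * expi (- s) \<omega>)"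
    by (rule Lim_transform_eventually)
  then show ?thesis
    by (simp add: LIMSEQ_const_iff)
qed

text \<open>Finite Parseval: the square expands into a double sum of which orthogonality keeps only
  the diagonal.\<close>

lemma integral_norm_trig_sum:
  assumes "finite I"
  shows "(LINT \<omega>|circ. (cmod (trig_sum a I \<omega>))\<^sup>2) = 2 * pi * (\<Sum>r\<in>I. (cmod (a r))\<^sup>2)"
proof -
  have int: "integrable circ (\<lambda>\<omega>. (a r * cnj (a s)) * expi (r - s) \<omega>)" for r s
    by (intro integrable_mult_right integrable_square_integrable_circ square_integrable_expi)
  have eq: "of_real ((cmod (trig_sum a I \<omega>))\<^sup>2) =
      (\<Sum>r\<in>I. \<Sum>s\<in>I. (a r * cnj (a s)) * expi (r - s) \<omega>)" for \<omega>
  proof -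
    have "expi r \<omega> * cnj (expi s \<omega>) = expi (r - s) \<omega>" for r s
      by (simp add: cis_cnj cis_mult left_diff_distrib)
    then have "(a r * expi r \<omega>) * cnj (a s * expi s \<omega>) = (a r * cnj (a s)) * expi (r - s) \<omega>" for r s
      by (metis (no_types) complex_cnj_mult mult.assoc mult.left_commute)
    then show ?thesis
      unfolding complex_norm_square trig_sum_def cnj_sum sum_product by (rule sum.cong[OF refl sum.cong[OF refl]])
  qed
  have "of_real (LINT \<omega>|circ. (cmod (trig_sum a I \<omega>))\<^sup>2) =
      (LINT \<omega>|circ. complex_of_real ((cmod (trig_sum a I \<omega>))\<^sup>2))"
    by (rule integral_complex_of_real[symmetric])
  also have "\<dots> = (\<Sum>r\<in>I. \<Sum>s\<in>I. (a r * cnj (a s)) * (LINT \<omega>|circ. expi (r - s) \<omega>))"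
    unfolding eq by (simp only: Bochner_Integration.integral_sum Bochner_Integration.integrable_sum int integral_mult_right_zero)
  also have "\<dots> = (\<Sum>r\<in>I. of_real (2 * pi) * (a r * cnj (a r)))"
    using assms by (simp only: integral_expi right_minus_eq)
      (simp add: if_distrib[of "\<lambda>x. _ * x"] mult.commute cong: if_cong)
  also have "\<dots> = of_real (2 * pi * (\<Sum>r\<in>I. (cmod (a r))\<^sup>2))"
    by (simp only: complex_norm_square[symmetric] sum_distrib_left of_real_mult of_real_sum)
  finally show ?thesis
    using of_real_eq_iff by blast
qed

text \<open>Both functions are L2 limits of the same partial sums, so their distance is bounded by
  quantities that tend to zero.\<close>

lemma fourier_series_L2_unique:
  assumes "fourier_series_L2 a g" "fourier_series_L2 a h"
  shows "AE \<omega> in circ. g \<omega> = h \<omega>"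
proof -
  let ?S = "\<lambda>n. trig_sum a {- int n..int n}"
  have g: "square_integrable circ g" and h: "square_integrable circ h"
    using assms by (auto simp: fourier_series_L2_iff)
  have S: "square_integrable circ (?S n)" for n
    by (rule square_integrable_trig_sum) simp
  have int: "integrable circ (\<lambda>\<omega>. (cmod (g \<omega> - h \<omega>))\<^sup>2)"
    using square_integrable_diff[OF g h] by (simp add: square_integrable_def)
  have lim: "(\<lambda>n. 2 * (LINT \<omega>|circ. (cmod (?S n \<omega> - h \<omega>))\<^sup>2) +
      2 * (LINT \<omega>|circ. (cmod (?S n \<omega> - g \<omega>))\<^sup>2)) \<longlonglongrightarrow> 2 * 0 + 2 * 0"
    using assms by (intro tendsto_intros) (auto simp: fourier_series_L2_iff)
  have "(LINT \<omega>|circ. (cmod (g \<omega> - h \<omega>))\<^sup>2) \<le> 2 * (LINT \<omega>|circ. (cmod (?S n \<omega> - h \<omega>))\<^sup>2) +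
      2 * (LINT \<omega>|circ. (cmod (?S n \<omega> - g \<omega>))\<^sup>2)" for n
  proof -
    have i1: "integrable circ (\<lambda>\<omega>. (cmod (?S n \<omega> - h \<omega>))\<^sup>2)"
      and i2: "integrable circ (\<lambda>\<omega>. (cmod (?S n \<omega> - g \<omega>))\<^sup>2)"
      using square_integrable_diff[OF S[of n] h] square_integrable_diff[OF S[of n] g]
      by (auto simp: square_integrable_def)
    have "(LINT \<omega>|circ. (cmod (g \<omega> - h \<omega>))\<^sup>2) \<le>
        (LINT \<omega>|circ. 2 * (cmod (?S n \<omega> - h \<omega>))\<^sup>2 + 2 * (cmod (?S n \<omega> - g \<omega>))\<^sup>2)"
    proof (rule integral_mono[OF int])
      show "(cmod (g \<omega> - h \<omega>))\<^sup>2 \<le> 2 * (cmod (?S n \<omega> - h \<omega>))\<^sup>2 + 2 * (cmod (?S n \<omega> - g \<omega>))\<^sup>2" for \<omega>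
        using norm_add_square_le[of "?S n \<omega> - h \<omega>" "- (?S n \<omega> - g \<omega>)"] 
        unfolding norm_minus_cancel by simp
    qed (use i1 i2 in auto)
    then show ?thesis
      using i1 i2 by simp
  qed
  then have "(LINT \<omega>|circ. (cmod (g \<omega> - h \<omega>))\<^sup>2) \<le> 2 * 0 + 2 * 0"
    by (intro LIMSEQ_le_const[OF lim]) blast
  then have "(LINT \<omega>|circ. (cmod (g \<omega> - h \<omega>))\<^sup>2) = 0"
    by (intro antisym Bochner_Integration.integral_nonneg) auto
  then have "AE \<omega> in circ. (cmod (g \<omega> - h \<omega>))\<^sup>2 = 0"
    by (subst (asm) integral_nonneg_eq_0_iff_AE[OF int]) auto
  then show ?thesis
    by simp
qed

text \<open>Convergent partial sums have bounded L2 norms, which finite Parseval turns into bounded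
  sums of squared coefficients. This is where square-summability comes from.\<close>

lemma fourier_series_L2_coefficients_bounded:
  assumes "fourier_series_L2 a g"
  shows "bdd_above (range (\<lambda>n. \<Sum>r=-int n..int n. (cmod (a r))\<^sup>2))"
proof -
  let ?S = "\<lambda>n. trig_sum a {- int n..int n}"
  let ?d = "\<lambda>n. LINT \<omega>|circ. (cmod (?S n \<omega> - g \<omega>))\<^sup>2"
  let ?G = "LINT \<omega>|circ. (cmod (g \<omega>))\<^sup>2"
  have g: "square_integrable circ g" and d: "?d \<longlonglongrightarrow> 0"
    using assms(1) by (auto simp: fourier_series_L2_iff)
  obtain B where B: "\<And>n. ?d n \<le> B"
    using convergent_imp_Bseq[OF convergentI[OF d]] by (auto simp: Bseq_def dest: abs_le_D1)
  have S: "square_integrable circ (?S n)" for n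
    by (rule square_integrable_trig_sum) simp
  have "(\<Sum>r=-int n..int n. (cmod (a r))\<^sup>2) \<le> (2 * B + 2 * ?G) / (2 * pi)" for n
  proof -
    have i1: "integrable circ (\<lambda>\<omega>. (cmod (?S n \<omega> - g \<omega>))\<^sup>2)"
      and i2: "integrable circ (\<lambda>\<omega>. (cmod (g \<omega>))\<^sup>2)" and i3: "integrable circ (\<lambda>\<omega>. (cmod (?S n \<omega>))\<^sup>2)"
      using square_integrable_diff[OF S[of n] g] g S[of n]
      by (auto simp: square_integrable_def)
    have "2 * pi * (\<Sum>r=-int n..int n. (cmod (a r))\<^sup>2) = (LINT \<omega>|circ. (cmod (?S n \<omega>))\<^sup>2)"
      by (rule integral_norm_trig_sum[symmetric]) simp
    also have "\<dots> \<le> (LINT \<omega>|circ. 2 * (cmod (?S n \<omega> - g \<omega>))\<^sup>2 + 2 * (cmod (g \<omega>))\<^sup>2)"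
    proof (rule integral_mono[OF i3])
      show "(cmod (?S n \<omega>))\<^sup>2 \<le> 2 * (cmod (?S n \<omega> - g \<omega>))\<^sup>2 + 2 * (cmod (g \<omega>))\<^sup>2" for \<omega>
        using norm_add_square_le[of "?S n \<omega> - g \<omega>" "g \<omega>"] by simp
    qed (use i1 i2 in auto)
    also have "\<dots> = 2 * ?d n + 2 * ?G"
      using i1 i2 by simp
    also have "\<dots> \<le> 2 * B + 2 * ?G"
      using B[of n] by simp
    finally show ?thesis
      by (simp add: field_simps)
  qed
  then show ?thesis
    by (auto intro!: bdd_aboveI)
qed

section \<open>Linear operations on Fourier series\<close>

lemma fourier_series_L2_add:
  assumes "fourier_series_L2 a g" "fourier_series_L2 b h"
  shows "fourier_series_L2 (\<lambda>r. a r + b r) (\<lambda>\<omega>. g \<omega> + h \<omega>)"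
proof -
  let ?S = "\<lambda>a n. trig_sum a {- int n..int n}"
  have g: "square_integrable circ g" and h: "square_integrable circ h"
    using assms by (auto simp: fourier_series_L2_iff)
  have S: "square_integrable circ (?S a n)" for a n
    by (rule square_integrable_trig_sum) simp
  have split: "?S (\<lambda>r. a r + b r) n \<omega> - (g \<omega> + h \<omega>) = (?S a n \<omega> - g \<omega>) + (?S b n \<omega> - h \<omega>)" for n \<omega>
    by (simp add: trig_sum_def distrib_right sum.distrib)
  have lim: "(\<lambda>n. 2 * (LINT \<omega>|circ. (cmod (?S a n \<omega> - g \<omega>))\<^sup>2) +
      2 * (LINT \<omega>|circ. (cmod (?S b n \<omega> - h \<omega>))\<^sup>2)) \<longlonglongrightarrow> 2 * 0 + 2 * 0"
    using assms by (intro tendsto_intros) (auto simp: fourier_series_L2_iff)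
  have le: "(LINT \<omega>|circ. (cmod (?S (\<lambda>r. a r + b r) n \<omega> - (g \<omega> + h \<omega>)))\<^sup>2) \<le>
      2 * (LINT \<omega>|circ. (cmod (?S a n \<omega> - g \<omega>))\<^sup>2) + 2 * (LINT \<omega>|circ. (cmod (?S b n \<omega> - h \<omega>))\<^sup>2)" for n
  proof -
    have i1: "integrable circ (\<lambda>\<omega>. (cmod (?S a n \<omega> - g \<omega>))\<^sup>2)"
      and i2: "integrable circ (\<lambda>\<omega>. (cmod (?S b n \<omega> - h \<omega>))\<^sup>2)"
      and i3: "integrable circ (\<lambda>\<omega>. (cmod ((?S a n \<omega> - g \<omega>) + (?S b n \<omega> - h \<omega>)))\<^sup>2)"
      using square_integrable_diff[OF S[of a n] g] square_integrable_diff[OF S[of b n] h]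
        square_integrable_add[OF square_integrable_diff[OF S[of a n] g] square_integrable_diff[OF S[of b n] h]]
      by (auto simp: square_integrable_def)
    have "(LINT \<omega>|circ. (cmod ((?S a n \<omega> - g \<omega>) + (?S b n \<omega> - h \<omega>)))\<^sup>2) \<le>
        (LINT \<omega>|circ. 2 * (cmod (?S a n \<omega> - g \<omega>))\<^sup>2 + 2 * (cmod (?S b n \<omega> - h \<omega>))\<^sup>2)"
      by (rule integral_mono[OF i3 _ norm_add_square_le]) (use i1 i2 in auto)
    then show ?thesis
      unfolding split using i1 i2 by simp
  qed
  have "(\<lambda>n. LINT \<omega>|circ. (cmod (?S (\<lambda>r. a r + b r) n \<omega> - (g \<omega> + h \<omega>)))\<^sup>2) \<longlonglongrightarrow> 0"
    by (rule tendsto_sandwich[OF _ _ tendsto_const lim[simplified]])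
       (use le in \<open>auto intro!: always_eventually\<close>)
  then show ?thesis
    using square_integrable_add[OF g h] by (simp add: fourier_series_L2_iff)
qed

lemma fourier_series_L2_cmult:
  assumes "fourier_series_L2 a g"
  shows "fourier_series_L2 (\<lambda>r. c * a r) (\<lambda>\<omega>. c * g \<omega>)"
proof -
  let ?S = "\<lambda>a n. trig_sum a {- int n..int n}"
  have g: "square_integrable circ g"
    and d: "(\<lambda>n. LINT \<omega>|circ. (cmod (?S a n \<omega> - g \<omega>))\<^sup>2) \<longlonglongrightarrow> 0"
    using assms by (auto simp: fourier_series_L2_iff)
  have "?S (\<lambda>r. c * a r) n \<omega> - c * g \<omega> = c * (?S a n \<omega> - g \<omega>)" for n \<omega>
    by (simp add: trig_sum_def right_diff_distrib sum_distrib_left mult.assoc)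
  then have "(LINT \<omega>|circ. (cmod (?S (\<lambda>r. c * a r) n \<omega> - c * g \<omega>))\<^sup>2) =
      (cmod c)\<^sup>2 * (LINT \<omega>|circ. (cmod (?S a n \<omega> - g \<omega>))\<^sup>2)" for n
    by (simp add: norm_mult power_mult_distrib)
  then show ?thesis
    using square_integrable_cmult[OF g] tendsto_mult_right_zero[OF d]
    by (simp add: fourier_series_L2_iff)
qed

lemma fourier_series_L2_zero: "fourier_series_L2 (\<lambda>_. 0) (\<lambda>_. 0)"
  by (simp add: fourier_series_L2_def square_integrable_def)

lemma fourier_series_L2_sum:
  assumes "finite I" "\<And>i. i \<in> I \<Longrightarrow> fourier_series_L2 (a i) (g i)"
  shows "fourier_series_L2 (\<lambda>r. \<Sum>i\<in>I. a i r) (\<lambda>\<omega>. \<Sum>i\<in>I. g i \<omega>)"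
  using assms
  by (induction I rule: finite_induct) (auto intro: fourier_series_L2_zero fourier_series_L2_add)

section \<open>Series with non-negative frequencies and their shifts\<close>

text \<open>The factor \<open>b\<close> is left arbitrary because it will be an exponential in some
  uses and an integral against a test function in others.\<close>

lemma sum_one_sided:
  "(\<Sum>r=-int n..int n. one_sided a r * b r) = (\<Sum>m\<le>n. a m * b (int m))"
proof -
  have "(\<Sum>r=-int n..int n. one_sided a r * b r) = (\<Sum>r\<in>int ` {..n}. one_sided a r * b r)"
  proof (rule sum.mono_neutral_right)
    show "\<forall>r\<in>{-int n..int n} - int ` {..n}. one_sided a r * b r = 0"
    proof
      fix r assume r: "r \<in> {-int n..int n} - int ` {..n}"
      have "\<not> 0 \<le> r"
      proof
        assume "0 \<le> r"
        then have "r = int (nat r)" "nat r \<le> n"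
          using r by auto
        with r show False
          by blast
      qed
      then show "one_sided a r * b r = 0"
        by (simp add: one_sided_def)
    qed
  qed auto
  also have "\<dots> = (\<Sum>m\<le>n. a m * b (int m))"
    by (simp add: sum.reindex one_sided_def)
  finally show ?thesis .
qed

lemma fourier_series_L2_one_sided_iff:
  "fourier_series_L2 (one_sided a) g \<longleftrightarrow> square_integrable circ g \<and>
    (\<lambda>n. LINT \<omega>|circ. (cmod ((\<Sum>m\<le>n. a m * expi (int m) \<omega>) - g \<omega>))\<^sup>2) \<longlonglongrightarrow> 0"
  by (simp only: fourier_series_L2_def sum_one_sided)

text \<open>For one-sided series the partial sum up to \<open>n + k\<close> of the shifted series is
  exactly \<open>expi (int k)\<close> times the partial sum up to \<open>n\<close>, so the errors
  agree. Symmetric windows would not be carried to symmetric windows.\<close>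

lemma fourier_series_L2_shift:
  assumes "fourier_series_L2 (one_sided a) g"
  shows "fourier_series_L2 (one_sided (\<lambda>m. if k \<le> m then a (m - k) else 0))
    (\<lambda>\<omega>. g \<omega> * expi (int k) \<omega>)"
proof -
  let ?b = "\<lambda>m. if k \<le> m then a (m - k) else 0"
  let ?d = "\<lambda>n. LINT \<omega>|circ. (cmod ((\<Sum>m\<le>n. a m * expi (int m) \<omega>) - g \<omega>))\<^sup>2"
  let ?d' = "\<lambda>n. LINT \<omega>|circ. (cmod ((\<Sum>m\<le>n. ?b m * expi (int m) \<omega>) - g \<omega> * expi (int k) \<omega>))\<^sup>2"
  have g: "square_integrable circ g" and d: "?d \<longlonglongrightarrow> 0"
    using assms by (auto simp: fourier_series_L2_one_sided_iff)
  have "?d' (n + k) = ?d n" for n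
  proof -
    have "(\<Sum>m\<le>n + k. ?b m * expi (int m) \<omega>) - g \<omega> * expi (int k) \<omega> =
        ((\<Sum>m\<le>n. a m * expi (int m) \<omega>) - g \<omega>) * expi (int k) \<omega>" for \<omega>
    proof -
      have "(\<Sum>m\<le>n + k. ?b m * expi (int m) \<omega>) = (\<Sum>m=0+k..n+k. ?b m * expi (int m) \<omega>)"
        by (rule sum.mono_neutral_right) auto
      also have "\<dots> = (\<Sum>m=0..n. ?b (m + k) * expi (int (m + k)) \<omega>)"
        by (rule sum.shift_bounds_cl_nat_ivl)
      also have "\<dots> = (\<Sum>m\<le>n. a m * expi (int m) \<omega>) * expi (int k) \<omega>"
        by (simp add: sum_distrib_right distrib_right cis_mult mult.assoc atLeast0AtMost)
      finally show ?thesis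
        by (simp add: left_diff_distrib)
    qed
    then show ?thesis
      by (simp only: norm_mult norm_cis mult_1_right)
  qed
  with d have "(\<lambda>n. ?d' (n + k)) \<longlonglongrightarrow> 0"
    by simp
  then have "?d' \<longlonglongrightarrow> 0"
    by (rule LIMSEQ_offset)
  then show ?thesis
    using square_integrable_times_expi[OF g] by (simp only: fourier_series_L2_one_sided_iff)
qed

lemma fourier_series_L2_expi:
  "fourier_series_L2 (one_sided (\<lambda>m. if m = k then 1 else 0)) (expi (int k))"
proof -
  have "(\<lambda>n. LINT \<omega>|circ. (cmod ((\<Sum>m\<le>n. (if m = k then 1 else 0) * expi (int m) \<omega>) - expi (int k) \<omega>))\<^sup>2)
      \<longlonglongrightarrow> 0"
  proof (rule tendsto_eventually, rule eventually_sequentiallyI)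
    fix n assume "k \<le> n"
    then show "(LINT \<omega>|circ. (cmod ((\<Sum>m\<le>n. (if m = k then 1 else 0) * expi (int m) \<omega>) - expi (int k) \<omega>))\<^sup>2) = 0"
      by (simp add: if_distrib[of "\<lambda>x. x * _"] cong: if_cong)
  qed
  then show ?thesis
    using square_integrable_expi[of "int k"] by (simp only: fourier_series_L2_one_sided_iff)
qed

lemma fourier_coefficient_one_sided:
  assumes "fourier_series_L2 (one_sided a) g"
  shows "(LINT \<omega>|circ. g \<omega> * expi s \<omega>) = (if s \<le> 0 then of_real (2*pi) * a (nat (- s)) else 0)"
  using fourier_coefficient[OF assms, of "- s"] by (simp add: one_sided_def)

subsection \<open>Injectivity of the Toeplitz operator\<close>

lemma ell2_one_sided:
  assumes "fourier_series_L2 (one_sided a) g"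
  shows "a \<in> ell2"
proof -
  obtain B where B: "\<And>n. (\<Sum>r=-int n..int n. (cmod (one_sided a r))\<^sup>2) \<le> B"
    using fourier_series_L2_coefficients_bounded[OF assms] by (auto simp: bdd_above_def)
  have "summable (\<lambda>n. (cmod (a n))\<^sup>2)"
  proof (rule summableI_nonneg_bounded)
    show "(\<Sum>m<n. (cmod (a m))\<^sup>2) \<le> B" for n
    proof -
      have "(\<Sum>m<n. (cmod (a m))\<^sup>2) = (\<Sum>r\<in>int ` {..<n}. (cmod (one_sided a r))\<^sup>2)"
        by (simp add: sum.reindex one_sided_def)
      also have "\<dots> \<le> (\<Sum>r=-int n..int n. (cmod (one_sided a r))\<^sup>2)"
        by (rule sum_mono2) auto
      finally show ?thesis
        using B[of n] by linarith
    qed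
  qed simp
  then show ?thesis
    by (simp add: ell2_def)
qed

lemma summable_mult_ell2:
  assumes "a \<in> ell2" "b \<in> ell2"
  shows "summable (\<lambda>n. a n * b n)"
proof (rule summable_comparison_test)
  show "summable (\<lambda>n. (cmod (a n))\<^sup>2 + (cmod (b n))\<^sup>2)"
    using assms by (auto simp: ell2_def intro: summable_add)
  have "norm (a n * b n) \<le> (cmod (a n))\<^sup>2 + (cmod (b n))\<^sup>2" for n
    using sum_squares_bound[of "cmod (a n)" "cmod (b n)"]
      mult_nonneg_nonneg[OF norm_ge_zero[of "a n"] norm_ge_zero[of "b n"]]
    unfolding norm_mult mult.assoc by linarith
  then show "\<exists>N. \<forall>n\<ge>N. norm (a n * b n) \<le> (cmod (a n))\<^sup>2 + (cmod (b n))\<^sup>2"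
    by blast
qed

lemma ell2_diff:
  assumes "a \<in> ell2" "b \<in> ell2"
  shows "(\<lambda>n. a n - b n) \<in> ell2"
proof -
  have s: "summable (\<lambda>n. 2 * (cmod (a n))\<^sup>2 + 2 * (cmod (b n))\<^sup>2)"
    using assms by (auto simp: ell2_def intro: summable_add summable_mult)
  have "norm ((cmod (a n - b n))\<^sup>2) \<le> 2 * (cmod (a n))\<^sup>2 + 2 * (cmod (b n))\<^sup>2" for n
    using norm_add_square_le[of "a n" "- b n"] by simp
  then have "summable (\<lambda>n. (cmod (a n - b n))\<^sup>2)"
    by (intro summable_comparison_test[OF _ s]) blast
  then show ?thesis
    by (simp add: ell2_def)
qed

text \<open>Row \<open>t\<close> is a reflected and translated piece of \<open>c\<close>. With
  \<open>summable_mult_ell2\<close> this makes the series in \<open>toeplitz c v t\<close>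
  convergent for \<open>v\<close> in \<open>ell2\<close>, so that its \<open>suminf\<close> is a
  genuine limit.\<close>

lemma toeplitz_row_ell2:
  assumes "fourier_series_L2 (\<lambda>r. of_real (c r)) g"
  shows "(\<lambda>\<tau>. complex_of_real (c (int t - int \<tau>))) \<in> ell2"
proof -
  obtain B where B: "\<And>n. (\<Sum>r=-int n..int n. (cmod (of_real (c r)))\<^sup>2) \<le> B"
    using fourier_series_L2_coefficients_bounded[OF assms] by (auto simp: bdd_above_def)
  have "summable (\<lambda>\<tau>. (cmod (of_real (c (int t - int \<tau>))))\<^sup>2)"
  proof (rule summableI_nonneg_bounded)
    show "(\<Sum>\<tau><n. (cmod (of_real (c (int t - int \<tau>))))\<^sup>2) \<le> B" for n
    proof -
      have inj: "inj_on (\<lambda>\<tau>. int t - int \<tau>) {..<n}"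
        by (auto simp: inj_on_def)
      have "(\<Sum>\<tau><n. (cmod (of_real (c (int t - int \<tau>))))\<^sup>2) =
          (\<Sum>r\<in>(\<lambda>\<tau>. int t - int \<tau>) ` {..<n}. (cmod (of_real (c r)))\<^sup>2)"
        by (subst sum.reindex[OF inj]) simp
      \<comment> \<open>Radius \<open>t + n\<close> is large enough to contain every
        \<open>t - \<tau>\<close> with \<open>\<tau> < n\<close>.\<close>
      also have "\<dots> \<le> (\<Sum>r=-int (t + n)..int (t + n). (cmod (of_real (c r)))\<^sup>2)"
        by (rule sum_mono2) auto
      finally show ?thesis
        using B[of "t + n"] by linarith
    qed
  qed simp
  then show ?thesis
    by (simp add: ell2_def)
qed

section \<open>Coercivity of the quadratic form and triviality of the kernel\<close>

text \<open>Let \<open>x\<close> and \<open>y\<close> be the trigonometric polynomials of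
  \<open>v\<close> over \<open>{..<N}\<close> and \<open>{N..<K}\<close>. Up to the factor
  \<open>2 * pi\<close>, the form is the integral of \<open>f (x + y) cnj x\<close>, whose real part
  is at least \<open>m |x|^2 - M |x| |y|\<close>. Two cutoffs are kept because each row
  \<open>t < N\<close> must be completed, by letting \<open>K\<close> grow, before \<open>N\<close>
  does.\<close>

lemma toeplitz_coercive:
  fixes v :: "nat \<Rightarrow> complex"
  assumes f: "fourier_series_L2 (\<lambda>r. of_real (c r)) (\<lambda>\<omega>. of_real (f \<omega>))"
    and bounds: "AE \<omega> in circ. m \<le> f \<omega>" "AE \<omega> in circ. f \<omega> \<le> M" and m: "0 < m"
    and "N \<le> K"
  shows "m / 2 * (\<Sum>t<N. (cmod (v t))\<^sup>2) - M\<^sup>2 / (2 * m) * (\<Sum>t=N..<K. (cmod (v t))\<^sup>2) \<le>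
    Re (\<Sum>t<N. cnj (v t) * (\<Sum>\<tau><K. of_real (c (int t - int \<tau>)) * v \<tau>))"
proof -
  define U where "U I = trig_sum (\<lambda>r. v (nat r)) (int ` I)" for I
  have U: "U I \<omega> = (\<Sum>t\<in>I. v t * expi (int t) \<omega>)" if "finite I" for I \<omega>
    by (simp add: U_def trig_sum_def sum.reindex)
  have U_sq: "square_integrable circ (U I)" if "finite I" for I
    unfolding U_def using that by (intro square_integrable_trig_sum) simp
  have U_norm: "(LINT \<omega>|circ. (cmod (U I \<omega>))\<^sup>2) = 2 * pi * (\<Sum>t\<in>I. (cmod (v t))\<^sup>2)" if "finite I" for I
    unfolding U_def using that by (subst integral_norm_trig_sum) (simp_all add: sum.reindex)
  have U_int: "integrable circ (\<lambda>\<omega>. (cmod (U I \<omega>))\<^sup>2)" if "finite I" for I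
    using U_sq[OF that] by (simp add: square_integrable_def)
  have fsq: "square_integrable circ (\<lambda>\<omega>. of_real (f \<omega>))"
    using f by (simp add: fourier_series_L2_def)
  have int: "integrable circ (\<lambda>\<omega>. (cnj (v t) * v \<tau>) * (of_real (f \<omega>) * expi (int \<tau> - int t) \<omega>))" for t \<tau>
    by (intro integrable_mult_right integrable_mult_square_integrable fsq square_integrable_expi)
  have eq: "of_real (f \<omega>) * U {..<K} \<omega> * cnj (U {..<N} \<omega>) =
      (\<Sum>t<N. \<Sum>\<tau><K. (cnj (v t) * v \<tau>) * (of_real (f \<omega>) * expi (int \<tau> - int t) \<omega>))" for \<omega>
  proof -
    have "expi (int \<tau> - int t) \<omega> = expi (int \<tau>) \<omega> * cnj (expi (int t) \<omega>)" for t \<tau>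
      by (simp add: cis_cnj cis_mult left_diff_distrib)
    then have "(cnj (v t) * v \<tau>) * (of_real (f \<omega>) * expi (int \<tau> - int t) \<omega>) =
        of_real (f \<omega>) * ((v \<tau> * expi (int \<tau>) \<omega>) * cnj (v t * expi (int t) \<omega>))" for t \<tau>
      by (simp only: complex_cnj_mult mult_ac)
    then show ?thesis
      by (subst sum.swap) (simp only: U finite_lessThan cnj_sum sum_product mult.assoc flip: sum_distrib_left)
  qed
  have coeff: "(LINT \<omega>|circ. of_real (f \<omega>) * expi (int \<tau> - int t) \<omega>) =
      of_real (2 * pi) * of_real (c (int t - int \<tau>))" for t \<tau>
    using fourier_coefficient[OF f, of "int t - int \<tau>"] by simp
  have int_form: "integrable circ (\<lambda>\<omega>. of_real (f \<omega>) * U {..<K} \<omega> * cnj (U {..<N} \<omega>))"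
    unfolding eq by (intro Bochner_Integration.integrable_sum int)
  have form: "(LINT \<omega>|circ. of_real (f \<omega>) * U {..<K} \<omega> * cnj (U {..<N} \<omega>)) =
      of_real (2 * pi) * (\<Sum>t<N. cnj (v t) * (\<Sum>\<tau><K. of_real (c (int t - int \<tau>)) * v \<tau>))"
    unfolding eq
    by (simp only: Bochner_Integration.integral_sum Bochner_Integration.integrable_sum int
        integral_mult_right_zero coeff) (simp only: sum_distrib_left mult_ac)
  have split: "U {..<K} \<omega> = U {..<N} \<omega> + U {N..<K} \<omega>" for \<omega>
    using sum.atLeastLessThan_concat[of 0 N K "\<lambda>t. v t * expi (int t) \<omega>"] assms(5)
    by (simp add: U atLeast0LessThan)
  have Re_mult: "Re (of_real x * z) = x * Re z" for x z
    by simp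
  have pointwise: "m / 2 * (cmod x)\<^sup>2 - M\<^sup>2 / (2 * m) * (cmod y)\<^sup>2 \<le> Re (of_real r * (x + y) * cnj x)"
    if "m \<le> r" "r \<le> M" for r x y
  proof -
    \<comment> \<open>Young's inequality, weighted so that the cross term costs exactly half of
      \<open>m |x|^2\<close>; this produces the constant \<open>M^2 / (2 * m)\<close>.\<close>
    have "0 \<le> (m * cmod x - M * cmod y)\<^sup>2 / (2 * m)"
      using m by simp
    also have "\<dots> = m / 2 * (cmod x)\<^sup>2 + M\<^sup>2 / (2 * m) * (cmod y)\<^sup>2 - M * (cmod x * cmod y)"
      using m by (simp add: field_simps power2_eq_square)
    finally have "M * (cmod x * cmod y) \<le> m / 2 * (cmod x)\<^sup>2 + M\<^sup>2 / (2 * m) * (cmod y)\<^sup>2"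
      by simp
    moreover have "r * (cmod x * cmod y) \<le> M * (cmod x * cmod y)"
      using that by (intro mult_right_mono) auto
    moreover have "m * (cmod x)\<^sup>2 \<le> r * (cmod x)\<^sup>2"
      using that by (intro mult_right_mono) auto
    moreover have "r * - (cmod x * cmod y) \<le> r * Re (y * cnj x)"
      using that m abs_Re_le_cmod[of "y * cnj x"]
      by (intro mult_left_mono) (auto simp: norm_mult mult.commute)
    moreover have "Re (of_real r * (x + y) * cnj x) = r * (cmod x)\<^sup>2 + r * Re (y * cnj x)"
    proof -
      have "of_real r * (x + y) * cnj x = of_real (r * (cmod x)\<^sup>2) + of_real r * (y * cnj x)"
        by (simp add: complex_norm_square algebra_simps del: of_real_power)
      then show ?thesis
        by (simp only: plus_complex.simps Re_complex_of_real Re_mult)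
    qed
    moreover have "m / 2 * (cmod x)\<^sup>2 = m * (cmod x)\<^sup>2 / 2"
      by simp
    ultimately show ?thesis
      by (simp only: mult_minus_right)
  qed
  have "(LINT \<omega>|circ. m / 2 * (cmod (U {..<N} \<omega>))\<^sup>2 - M\<^sup>2 / (2 * m) * (cmod (U {N..<K} \<omega>))\<^sup>2) \<le>
      (LINT \<omega>|circ. Re (of_real (f \<omega>) * U {..<K} \<omega> * cnj (U {..<N} \<omega>)))"
  proof (rule integral_mono_AE)
    show "integrable circ (\<lambda>\<omega>. m / 2 * (cmod (U {..<N} \<omega>))\<^sup>2 - M\<^sup>2 / (2 * m) * (cmod (U {N..<K} \<omega>))\<^sup>2)"
      by (intro Bochner_Integration.integrable_diff integrable_mult_right U_int) auto
    show "integrable circ (\<lambda>\<omega>. Re (of_real (f \<omega>) * U {..<K} \<omega> * cnj (U {..<N} \<omega>)))"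
      using int_form by (rule integrable_Re)
    show "AE \<omega> in circ. m / 2 * (cmod (U {..<N} \<omega>))\<^sup>2 - M\<^sup>2 / (2 * m) * (cmod (U {N..<K} \<omega>))\<^sup>2 \<le>
        Re (of_real (f \<omega>) * U {..<K} \<omega> * cnj (U {..<N} \<omega>))"
      using bounds
    proof eventually_elim
      case (elim \<omega>)
      then show ?case
        unfolding split by (rule pointwise)
    qed
  qed
  also have "\<dots> = Re (LINT \<omega>|circ. of_real (f \<omega>) * U {..<K} \<omega> * cnj (U {..<N} \<omega>))"
    using int_form by (rule integral_Re)
  also have "\<dots> = 2 * pi * Re (\<Sum>t<N. cnj (v t) * (\<Sum>\<tau><K. of_real (c (int t - int \<tau>)) * v \<tau>))"
    unfolding form by (simp only: Re_mult)
  also have "(LINT \<omega>|circ. m / 2 * (cmod (U {..<N} \<omega>))\<^sup>2 - M\<^sup>2 / (2 * m) * (cmod (U {N..<K} \<omega>))\<^sup>2) =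
      2 * pi * (m / 2 * (\<Sum>t<N. (cmod (v t))\<^sup>2) - M\<^sup>2 / (2 * m) * (\<Sum>t=N..<K. (cmod (v t))\<^sup>2))"
    by (simp only: Bochner_Integration.integral_diff integrable_mult_right U_int finite_lessThan
        finite_atLeastLessThan integral_mult_right_zero U_norm)
      (simp only: right_diff_distrib mult_ac)
  finally show ?thesis
    by (rule mult_left_le_imp_le) simp
qed

text \<open>Density of the reals in the extended reals yields a real bound strictly below the
  essential infimum, even if that is infinite. As \<open>essinf\<close> is a negated
  \<open>esssup\<close>, the bound for \<open>- f\<close> is reflected.\<close>

lemma essinf_pos_AE:
  assumes "0 < essinf M (\<lambda>x. ereal (f x))"
  obtains m where "0 < m" "AE x in M. m \<le> f x"
proof -
  obtain m where m: "0 < m" "ereal m < essinf M (\<lambda>x. ereal (f x))"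
    using ereal_dense2[OF assms] by (auto simp: zero_ereal_def)
  have "AE x in M. m \<le> f x"
    using esssup_AE[of "\<lambda>x. - ereal (f x)" M]
  proof eventually_elim
    case (elim x)
    then have "essinf M (\<lambda>x. ereal (f x)) \<le> ereal (f x)"
      unfolding essinf_def by (metis ereal_minus_le_minus ereal_uminus_uminus)
    with m(2) have "ereal m < ereal (f x)"
      by (rule less_le_trans)
    then show ?case
      by simp
  qed
  with m(1) show thesis
    by (rule that)
qed

lemma esssup_finite_AE:
  assumes "esssup M (\<lambda>x. ereal (f x)) < \<infinity>"
  obtains B where "AE x in M. f x \<le> B"
proof -
  obtain B where B: "esssup M (\<lambda>x. ereal (f x)) < ereal B"
    using ereal_dense2[OF assms] by auto
  have "AE x in M. f x \<le> B"
    using esssup_AE[of "\<lambda>x. ereal (f x)" M]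
  proof eventually_elim
    case (elim x)
    then have "ereal (f x) < ereal B"
      using B by (rule le_less_trans)
    then show ?case
      by simp
  qed
  then show thesis
    by (rule that)
qed

text \<open>With \<open>N\<close> fixed, letting \<open>K\<close> tend to infinity in the coercive
  estimate sends the quadratic form to zero, because every row sum tends to an entry of
  \<open>T v = 0\<close>. The first \<open>N\<close> squares are then bounded by a multiple of the
  tail, and the tail vanishes as \<open>N\<close> grows.\<close>

lemma toeplitz_kernel:
  assumes f: "fourier_series_L2 (\<lambda>r. of_real (c r)) (\<lambda>\<omega>. of_real (f \<omega>))"
    and bounds: "AE \<omega> in circ. m \<le> f \<omega>" "AE \<omega> in circ. f \<omega> \<le> M" and m: "0 < m"
    and v: "v \<in> ell2" and T: "\<And>t. toeplitz c v t = 0"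
  shows "v = (\<lambda>_. 0)"
proof -
  have sv: "summable (\<lambda>n. (cmod (v n))\<^sup>2)"
    using v by (simp add: ell2_def)
  let ?P = "\<lambda>N. \<Sum>t<N. (cmod (v t))\<^sup>2"
  let ?S = "\<Sum>n. (cmod (v n))\<^sup>2"
  have P: "?P \<longlonglongrightarrow> ?S"
    using sv by (rule summable_LIMSEQ)
  have row: "(\<lambda>K. \<Sum>\<tau><K. of_real (c (int t - int \<tau>)) * v \<tau>) \<longlonglongrightarrow> 0" for t
    using summable_LIMSEQ[OF summable_mult_ell2[OF toeplitz_row_ell2[OF f, of t] v]] T[of t]
    by (simp add: toeplitz_def)
  have tail: "m / 2 * ?P N \<le> M\<^sup>2 / (2 * m) * (?S - ?P N)" for N
  proof -
    let ?F = "\<lambda>K. \<Sum>t<N. cnj (v t) * (\<Sum>\<tau><K. of_real (c (int t - int \<tau>)) * v \<tau>)"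
    have "?F \<longlonglongrightarrow> (\<Sum>t<N. cnj (v t) * 0)"
      by (intro tendsto_intros row)
    then have "(\<lambda>K. Re (?F K)) \<longlonglongrightarrow> 0"
      using tendsto_Re by fastforce
    moreover have "\<forall>K\<ge>N. m / 2 * ?P N - M\<^sup>2 / (2 * m) * (?P K - ?P N) \<le> Re (?F K)"
    proof (intro allI impI)
      fix K assume "N \<le> K"
      moreover have "(\<Sum>t=N..<K. (cmod (v t))\<^sup>2) = ?P K - ?P N"
        using sum.atLeastLessThan_concat[of 0 N K "\<lambda>t. (cmod (v t))\<^sup>2"] \<open>N \<le> K\<close>
        by (simp add: atLeast0LessThan)
      ultimately show "m / 2 * ?P N - M\<^sup>2 / (2 * m) * (?P K - ?P N) \<le> Re (?F K)"
        using toeplitz_coercive[OF f bounds m, of N K v] by simp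
    qed
    moreover have "(\<lambda>K. m / 2 * ?P N - M\<^sup>2 / (2 * m) * (?P K - ?P N)) \<longlonglongrightarrow>
        m / 2 * ?P N - M\<^sup>2 / (2 * m) * (?S - ?P N)"
      by (intro tendsto_intros P)
    ultimately have "m / 2 * ?P N - M\<^sup>2 / (2 * m) * (?S - ?P N) \<le> 0"
      by (intro LIMSEQ_le) auto
    then show ?thesis
      by simp
  qed
  \<comment> \<open>The limit of \<open>tail\<close> in \<open>N\<close>; its right side is zero,
    which forces \<open>?S\<close> to vanish.\<close>
  have "m / 2 * ?S \<le> M\<^sup>2 / (2 * m) * (?S - ?S)"
  proof (rule LIMSEQ_le)
    show "(\<lambda>N. m / 2 * ?P N) \<longlonglongrightarrow> m / 2 * ?S"
      by (intro tendsto_intros P)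
    show "(\<lambda>N. M\<^sup>2 / (2 * m) * (?S - ?P N)) \<longlonglongrightarrow> M\<^sup>2 / (2 * m) * (?S - ?S)"
      by (intro tendsto_intros P)
  qed (use tail in blast)
  then have "?S \<le> 0"
    using m by (simp add: mult_le_0_iff)
  moreover have "0 \<le> ?S"
    using sv by (intro suminf_nonneg) auto
  ultimately have "?S = 0"
    by (rule antisym)
  then have "\<forall>n. (cmod (v n))\<^sup>2 = 0"
    using suminf_eq_zero_iff[OF sv] by simp
  then show ?thesis
    by (auto simp: fun_eq_iff)
qed

text \<open>Each row series converges on \<open>ell2\<close>, so \<open>toeplitz c\<close> respects
  differences there and injectivity reduces to the kernel.\<close>

lemma toeplitz_inj_on:
  assumes f: "fourier_series_L2 (\<lambda>r. of_real (c r)) (\<lambda>\<omega>. of_real (f \<omega>))"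
    and bounds: "AE \<omega> in circ. m \<le> f \<omega>" "AE \<omega> in circ. f \<omega> \<le> M" and m: "0 < m"
  shows "inj_on (toeplitz c) ell2"
proof (rule inj_onI)
  fix u v assume uv: "u \<in> ell2" "v \<in> ell2" "toeplitz c u = toeplitz c v"
  have "toeplitz c (\<lambda>n. u n - v n) t = toeplitz c u t - toeplitz c v t" for t
    using summable_mult_ell2[OF toeplitz_row_ell2[OF f, of t] uv(1)]
      summable_mult_ell2[OF toeplitz_row_ell2[OF f, of t] uv(2)]
    by (simp add: toeplitz_def right_diff_distrib suminf_diff)
  then have "(\<lambda>n. u n - v n) = (\<lambda>_. 0)"
    using uv by (intro toeplitz_kernel[OF f bounds m] ell2_diff) auto
  then show "u = v"
    by (auto simp: fun_eq_iff dest: fun_cong)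
qed

subsection \<open>Inversion by the spectral factors\<close>

text \<open>Bridges the closed interval of the integral formula for the entries and the half-open
  interval of \<open>circ\<close>; they differ by one null point.\<close>

lemma set_integral_circ:
  fixes g :: "real \<Rightarrow> complex"
  assumes "g \<in> borel_measurable circ"
  shows "(LINT \<omega>:{0..2*pi}|lebesgue. g \<omega>) = (LINT \<omega>|circ. g \<omega>)"
proof -
  let ?h = "\<lambda>\<omega>. indicator {0..<2*pi} \<omega> *\<^sub>R g \<omega>"
  have h [measurable]: "?h \<in> borel_measurable lebesgue"
    using assms by (subst (asm) borel_measurable_restrict_space_iff) auto
  \<comment> \<open>Measurability of \<open>g\<close> is known only on the half-open interval, so
    its value at \<open>2*pi\<close> is split off as a constant times the indicator of a
    singleton.\<close>
  have eq: "indicator {0..2*pi} \<omega> *\<^sub>R g \<omega> = ?h \<omega> + indicator {2*pi} \<omega> *\<^sub>R g (2*pi)" for \<omega>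
    by (auto simp: indicator_def)
  have "(LINT \<omega>:{0..2*pi}|lebesgue. g \<omega>) = (LINT \<omega>|lebesgue. ?h \<omega> + indicator {2*pi} \<omega> *\<^sub>R g (2*pi))"
    unfolding set_lebesgue_integral_def eq ..
  also have "\<dots> = (LINT \<omega>|lebesgue. ?h \<omega>)"
  proof (rule integral_cong_AE)
    have "AE \<omega> in lebesgue. \<omega> \<notin> {2*pi}"
      by (rule AE_not_in) (simp add: negligible_iff_null_sets[symmetric])
    then show "AE \<omega> in lebesgue. ?h \<omega> + indicator {2*pi} \<omega> *\<^sub>R g (2*pi) = ?h \<omega>"
      by eventually_elim simp
    have "(\<lambda>\<omega>. indicator {2*pi} \<omega> *\<^sub>R g (2*pi)) \<in> borel_measurable lebesgue"
      by (intro borel_measurable_scaleR borel_measurable_indicator borel_measurable_const) simp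
    with h show "(\<lambda>\<omega>. ?h \<omega> + indicator {2*pi} \<omega> *\<^sub>R g (2*pi)) \<in> borel_measurable lebesgue"
      by (rule borel_measurable_add)
  qed (rule h)
  also have "\<dots> = (LINT \<omega>|circ. g \<omega>)"
    by (rule integral_restrict_space[symmetric]) simp
  finally show ?thesis .
qed

section \<open>The explicit solution of \<open>T(f) v = e_k\<close>\<close>

text \<open>These are the Fourier coefficients of \<open>g * h = 1\<close>. The series of
  \<open>g\<close> is integrated against \<open>h * expi (- int n)\<close>; since \<open>h\<close>
  is one-sided, only frequencies \<open>m \<le> n\<close> contribute and the sum is finite.\<close>

lemma fourier_series_L2_convolution_inverse:
  assumes a: "fourier_series_L2 (one_sided a) g" and b: "fourier_series_L2 (one_sided b) h"
    and inv: "AE \<omega> in circ. g \<omega> * h \<omega> = 1"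
  shows "(\<Sum>i\<le>n. a i * b (n - i)) = (if n = 0 then 1 else 0)"
proof -
  have h: "square_integrable circ h" and g: "square_integrable circ g"
    using assms by (auto simp: fourier_series_L2_def)
  let ?I = "\<lambda>m. LINT \<omega>|circ. expi (int m) \<omega> * (h \<omega> * expi (- int n) \<omega>)"
  have I: "?I m = (if m \<le> n then of_real (2*pi) * b (n - m) else 0)" for m
  proof -
    have "expi (int m) \<omega> * (h \<omega> * expi (- int n) \<omega>) = h \<omega> * expi (int m - int n) \<omega>" for \<omega>
      by (subst mult.left_commute) (simp add: cis_mult left_diff_distrib)
    then have "?I m = (LINT \<omega>|circ. h \<omega> * expi (int m - int n) \<omega>)"
      by (rule arg_cong[OF ext])
    also have "\<dots> = (if m \<le> n then of_real (2*pi) * b (n - m) else 0)"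
      unfolding fourier_coefficient_one_sided[OF b] by (simp add: nat_diff_distrib)
    finally show ?thesis .
  qed
  have "(\<lambda>N. \<Sum>m\<le>N. a m * ?I m) \<longlonglongrightarrow> (LINT \<omega>|circ. g \<omega> * (h \<omega> * expi (- int n) \<omega>))"
    using fourier_series_L2_integral_mult[OF a square_integrable_times_expi[OF h]]
    unfolding sum_one_sided .
  moreover have "eventually (\<lambda>N. (\<Sum>m\<le>N. a m * ?I m) = of_real (2*pi) * (\<Sum>i\<le>n. a i * b (n - i))) sequentially"
  proof (rule eventually_sequentiallyI)
    fix N assume "n \<le> N"
    then have "(\<Sum>m\<le>N. a m * ?I m) = (\<Sum>m\<le>n. a m * ?I m)"
      unfolding I by (intro sum.mono_neutral_right) auto
    then show "(\<Sum>m\<le>N. a m * ?I m) = of_real (2*pi) * (\<Sum>i\<le>n. a i * b (n - i))"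
      unfolding I by (simp add: sum_distrib_left mult_ac)
  qed
  ultimately have "(\<lambda>_. of_real (2*pi) * (\<Sum>i\<le>n. a i * b (n - i))) \<longlonglongrightarrow>
      (LINT \<omega>|circ. g \<omega> * (h \<omega> * expi (- int n) \<omega>))"
    by (rule Lim_transform_eventually)
  then have "of_real (2*pi) * (\<Sum>i\<le>n. a i * b (n - i)) =
      (LINT \<omega>|circ. g \<omega> * (h \<omega> * expi (- int n) \<omega>))"
    by (simp add: LIMSEQ_const_iff)
  also have "\<dots> = (LINT \<omega>|circ. expi (- int n) \<omega>)"
  proof (rule integral_cong_AE)
    show "(\<lambda>\<omega>. g \<omega> * (h \<omega> * expi (- int n) \<omega>)) \<in> borel_measurable circ"
      using g h by (intro borel_measurable_times cis_measurable_circ) (auto simp: square_integrable_def)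
    show "AE \<omega> in circ. g \<omega> * (h \<omega> * expi (- int n) \<omega>) = expi (- int n) \<omega>"
      using inv by eventually_elim (simp flip: mult.assoc)
  qed (rule cis_measurable_circ)
  finally show ?thesis
    unfolding integral_expi by (simp split: if_splits)
qed

text \<open>Multiplying by a polynomial in \<open>expi 1\<close> combines finitely many shifts, so
  the coefficients are truncated convolutions. The guard \<open>i \<le> j\<close> marks the zeros to
  the left of a shifted series, where \<open>j - i\<close> would be cut off at 0.\<close>

lemma fourier_series_L2_finite_combination:
  assumes "fourier_series_L2 (one_sided b) h"
  shows "fourier_series_L2 (one_sided (\<lambda>j. \<Sum>i\<le>k. q i * (if i \<le> j then b (j - i) else 0)))
    (\<lambda>\<omega>. h \<omega> * (\<Sum>i\<le>k. q i * expi (int i) \<omega>))"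
proof -
  have "fourier_series_L2 (\<lambda>r. \<Sum>i\<le>k. q i * one_sided (\<lambda>m. if i \<le> m then b (m - i) else 0) r)
      (\<lambda>\<omega>. \<Sum>i\<le>k. q i * (h \<omega> * expi (int i) \<omega>))"
    by (intro fourier_series_L2_sum fourier_series_L2_cmult fourier_series_L2_shift assms) simp
  moreover have "(\<lambda>r. \<Sum>i\<le>k. q i * one_sided (\<lambda>m. if i \<le> m then b (m - i) else 0) r) =
      one_sided (\<lambda>j. \<Sum>i\<le>k. q i * (if i \<le> j then b (j - i) else 0))"
    by (rule ext) (simp add: one_sided_def)
  moreover have "(\<lambda>\<omega>. \<Sum>i\<le>k. q i * (h \<omega> * expi (int i) \<omega>)) =
      (\<lambda>\<omega>. h \<omega> * (\<Sum>i\<le>k. q i * expi (int i) \<omega>))"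
    by (rule ext) (simp only: sum_distrib_left mult.left_commute)
  ultimately show ?thesis
    by simp
qed

text \<open>Entry \<open>t\<close> of \<open>T w\<close> is the Fourier coefficient of
  \<open>f D\<close> at \<open>t\<close>: in the series of \<open>D\<close>, tested against
  \<open>f * expi (- int t)\<close>, frequency \<open>\<tau>\<close> contributes
  \<open>2 * pi * c (t - \<tau>)\<close>.\<close>

lemma toeplitz_integral:
  assumes f: "fourier_series_L2 (\<lambda>r. of_real (c r)) (\<lambda>\<omega>. of_real (f \<omega>))"
    and D: "fourier_series_L2 (one_sided w) D"
  shows "of_real (2*pi) * toeplitz c w t = (LINT \<omega>|circ. D \<omega> * (of_real (f \<omega>) * expi (- int t) \<omega>))"
proof -
  have fsq: "square_integrable circ (\<lambda>\<omega>. of_real (f \<omega>))"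
    using f by (simp add: fourier_series_L2_def)
  have coeff: "(LINT \<omega>|circ. expi (int \<tau>) \<omega> * (of_real (f \<omega>) * expi (- int t) \<omega>)) =
      of_real (2*pi) * of_real (c (int t - int \<tau>))" for \<tau>
  proof -
    have "expi (int \<tau>) \<omega> * (of_real (f \<omega>) * expi (- int t) \<omega>) =
        of_real (f \<omega>) * expi (- (int t - int \<tau>)) \<omega>" for \<omega>
      by (subst mult.left_commute) (simp add: cis_mult left_diff_distrib)
    then have "(LINT \<omega>|circ. expi (int \<tau>) \<omega> * (of_real (f \<omega>) * expi (- int t) \<omega>)) =
        (LINT \<omega>|circ. of_real (f \<omega>) * expi (- (int t - int \<tau>)) \<omega>)"
      by (rule arg_cong[OF ext])
    also have "\<dots> = of_real (2*pi) * of_real (c (int t - int \<tau>))"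
      by (rule fourier_coefficient[OF f])
    finally show ?thesis .
  qed
  have "(\<lambda>n. \<Sum>\<tau>\<le>n. w \<tau> * (of_real (2*pi) * of_real (c (int t - int \<tau>)))) \<longlonglongrightarrow>
      (LINT \<omega>|circ. D \<omega> * (of_real (f \<omega>) * expi (- int t) \<omega>))"
    using fourier_series_L2_integral_mult[OF D square_integrable_times_expi[OF fsq, of "- int t"]]
    unfolding sum_one_sided coeff .
  moreover have "(\<lambda>n. of_real (2*pi) * (\<Sum>\<tau>\<le>n. of_real (c (int t - int \<tau>)) * w \<tau>)) \<longlonglongrightarrow>
      of_real (2*pi) * toeplitz c w t"
    unfolding toeplitz_def
    by (intro tendsto_intros summable_LIMSEQ' summable_mult_ell2 toeplitz_row_ell2[OF f] ell2_one_sided[OF D])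
  ultimately show ?thesis
    by (intro LIMSEQ_unique) (simp only: sum_distrib_left mult_ac)+
qed

text \<open>For \<open>D = h p / s\<close>, with \<open>p\<close> having coefficients
  \<open>b (k - i)\<close>, the factorization turns \<open>f D\<close> into
  \<open>cnj g * p\<close>. Its coefficient at \<open>t \<ge> 0\<close> is the convolution of
  \<open>a\<close> and \<open>b\<close> at \<open>k - t\<close>, which is 1 for \<open>t = k\<close>
  and 0 otherwise.\<close>

lemma toeplitz_factor_column:
  assumes f: "fourier_series_L2 (\<lambda>r. of_real (c r)) (\<lambda>\<omega>. of_real (f \<omega>))"
    and a: "fourier_series_L2 (one_sided a) g" and b: "fourier_series_L2 (one_sided b) h"
    and real: "\<And>n. cnj (a n) = a n"
    and inv: "AE \<omega> in circ. g \<omega> * h \<omega> = 1"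
    and factor: "AE \<omega> in circ. f \<omega> = s * (cmod (g \<omega>))\<^sup>2" and s: "s > 0"
  shows "toeplitz c (\<lambda>j. \<Sum>i\<le>k. inverse (of_real s) * b (k - i) * (if i \<le> j then b (j - i) else 0)) =
    unit_seq k"
proof
  fix t
  let ?q = "\<lambda>i. inverse (of_real s) * b (k - i)"
  let ?D = "\<lambda>\<omega>. h \<omega> * (\<Sum>i\<le>k. ?q i * expi (int i) \<omega>)"
  have D: "fourier_series_L2 (one_sided (\<lambda>j. \<Sum>i\<le>k. ?q i * (if i \<le> j then b (j - i) else 0))) ?D"
    by (rule fourier_series_L2_finite_combination[OF b])
  have g_sq: "square_integrable circ (\<lambda>\<omega>. cnj (g \<omega>))"
    using a by (intro square_integrable_cnj) (simp add: fourier_series_L2_def)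
  have int: "integrable circ (\<lambda>\<omega>. b (k - i) * (cnj (g \<omega>) * expi (int i - int t) \<omega>))" for i
    by (intro integrable_mult_right integrable_mult_square_integrable g_sq square_integrable_expi)
  \<comment> \<open>Conjugation reverses frequencies, so only \<open>i \<ge> t\<close> survives;
    \<open>real\<close> removes the conjugate from the coefficient.\<close>
  have g_coeff: "(LINT \<omega>|circ. cnj (g \<omega>) * expi (int i - int t) \<omega>) =
      (if t \<le> i then of_real (2*pi) * a (i - t) else 0)" for i
  proof -
    have "cnj (g \<omega>) * expi (int i - int t) \<omega> = cnj (g \<omega> * expi (int t - int i) \<omega>)" for \<omega>
      by (simp add: cis_cnj left_diff_distrib)
    then have "(LINT \<omega>|circ. cnj (g \<omega>) * expi (int i - int t) \<omega>) =
        (LINT \<omega>|circ. cnj (g \<omega> * expi (int t - int i) \<omega>))"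
      by (rule arg_cong[OF ext])
    also have "\<dots> = cnj (LINT \<omega>|circ. g \<omega> * expi (int t - int i) \<omega>)"
      by (rule Bochner_Integration.integral_cnj)
    also have "\<dots> = (if t \<le> i then of_real (2*pi) * a (i - t) else 0)"
      unfolding fourier_coefficient_one_sided[OF a] by (simp add: real nat_diff_distrib)
    finally show ?thesis .
  qed
  have "of_real (2*pi) * toeplitz c (\<lambda>j. \<Sum>i\<le>k. ?q i * (if i \<le> j then b (j - i) else 0)) t =
      (LINT \<omega>|circ. ?D \<omega> * (of_real (f \<omega>) * expi (- int t) \<omega>))"
    by (rule toeplitz_integral[OF f D])
  also have "\<dots> = (LINT \<omega>|circ. (\<Sum>i\<le>k. b (k - i) * (cnj (g \<omega>) * expi (int i - int t) \<omega>)))"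
  proof (rule integral_cong_AE)
    have "?D \<in> borel_measurable circ" "(\<lambda>\<omega>. complex_of_real (f \<omega>)) \<in> borel_measurable circ"
      using D f by (auto simp only: fourier_series_L2_def square_integrable_def)
    then show "(\<lambda>\<omega>. ?D \<omega> * (of_real (f \<omega>) * expi (- int t) \<omega>)) \<in> borel_measurable circ"
      by (rule borel_measurable_times[OF _ borel_measurable_times[OF _ cis_measurable_circ]])
    show "(\<lambda>\<omega>. \<Sum>i\<le>k. b (k - i) * (cnj (g \<omega>) * expi (int i - int t) \<omega>)) \<in> borel_measurable circ"
      using int by (intro borel_measurable_sum) (rule borel_measurable_integrable)
    show "AE \<omega> in circ. ?D \<omega> * (of_real (f \<omega>) * expi (- int t) \<omega>) =
        (\<Sum>i\<le>k. b (k - i) * (cnj (g \<omega>) * expi (int i - int t) \<omega>))"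
      using inv factor
    proof eventually_elim
      case (elim \<omega>)
      \<comment> \<open>Of the two factors in \<open>|g|^2 = g * cnj g\<close>, the first is
        cancelled by \<open>h\<close>.\<close>
      have "of_real (f \<omega>) = of_real s * (g \<omega> * cnj (g \<omega>))"
        using elim(2) by (simp add: complex_norm_square del: of_real_power)
      then have "h \<omega> * of_real (f \<omega>) = of_real s * (g \<omega> * h \<omega>) * cnj (g \<omega>)"
        by (simp only: mult_ac)
      also have "\<dots> = of_real s * cnj (g \<omega>)"
        using elim(1) by simp
      finally have hf: "h \<omega> * of_real (f \<omega>) = of_real s * cnj (g \<omega>)" .
      have "?D \<omega> * (of_real (f \<omega>) * expi (- int t) \<omega>) =
          (h \<omega> * of_real (f \<omega>)) * ((\<Sum>i\<le>k. ?q i * expi (int i) \<omega>) * expi (- int t) \<omega>)"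
        by (simp only: mult_ac)
      also have "\<dots> = (\<Sum>i\<le>k. (of_real s * inverse (of_real s)) *
          (b (k - i) * (cnj (g \<omega>) * (expi (int i) \<omega> * expi (- int t) \<omega>))))"
        unfolding hf sum_distrib_left sum_distrib_right by (simp only: mult_ac)
      also have "\<dots> = (\<Sum>i\<le>k. b (k - i) * (cnj (g \<omega>) * expi (int i - int t) \<omega>))"
        using s by (simp add: cis_mult left_diff_distrib)
      finally show ?case .
    qed
  qed
  also have "\<dots> = (\<Sum>i\<le>k. b (k - i) * (if t \<le> i then of_real (2*pi) * a (i - t) else 0))"
    by (simp only: Bochner_Integration.integral_sum int integral_mult_right_zero g_coeff)
  also have "\<dots> = of_real (2*pi) * unit_seq k t"
  proof (cases "t \<le> k")
    case True
    \<comment> \<open>Terms with \<open>i < t\<close> vanish; replacing \<open>i\<close> by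
      \<open>i + t\<close> turns \<open>k - i\<close> into \<open>k - t - i\<close> and exhibits the
      convolution at \<open>k - t\<close>.\<close>
    have "(\<Sum>i\<le>k. b (k - i) * (if t \<le> i then of_real (2*pi) * a (i - t) else 0)) =
        (\<Sum>i=0+t..(k-t)+t. b (k - i) * (if t \<le> i then of_real (2*pi) * a (i - t) else 0))"
      using True by (intro sum.mono_neutral_right) auto
    also have "\<dots> = (\<Sum>i\<le>k-t. b (k - t - i) * (of_real (2*pi) * a i))"
      unfolding sum.shift_bounds_cl_nat_ivl atLeast0AtMost
      by (intro sum.cong) (auto simp: add.commute)
    also have "\<dots> = of_real (2*pi) * (\<Sum>i\<le>k-t. a i * b (k - t - i))"
      by (simp only: sum_distrib_left mult_ac)
    also have "\<dots> = of_real (2*pi) * unit_seq k t"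
      unfolding fourier_series_L2_convolution_inverse[OF a b inv] using True by (auto simp: unit_seq_def)
    finally show ?thesis .
  \<comment> \<open>For \<open>t > k\<close> no index satisfies \<open>t \<le> i \<le> k\<close>, so
    both sides are zero.\<close>
  qed (auto simp: unit_seq_def intro!: sum.neutral)
  finally show "toeplitz c (\<lambda>j. \<Sum>i\<le>k. ?q i * (if i \<le> j then b (j - i) else 0)) t = unit_seq k t"
    by simp
qed

text \<open>Solving \<open>T(f) v = e_j\<close> yields columns of the inverse, whereas rows are
  wanted. Both sums effectively run over \<open>i \<le> min j k\<close>, where the summand is
  symmetric in \<open>j\<close> and \<open>k\<close>.\<close>

lemma factor_matrix_symmetric:
  fixes b :: "nat \<Rightarrow> complex"
  shows "(\<Sum>i\<le>j. s * b (j - i) * (if i \<le> k then b (k - i) else 0)) =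
    (\<Sum>i\<le>k. s * b (k - i) * (if i \<le> j then b (j - i) else 0))"
proof -
  have "(\<Sum>i\<le>j. s * b (j - i) * (if i \<le> k then b (k - i) else 0)) =
      (\<Sum>i\<le>min j k. s * b (j - i) * b (k - i))"
    by (rule sum.mono_neutral_cong_right) auto
  also have "\<dots> = (\<Sum>i\<le>k. s * b (k - i) * (if i \<le> j then b (j - i) else 0))"
    by (rule sum.mono_neutral_cong_left) auto
  finally show ?thesis .
qed

text \<open>Injectivity on \<open>ell2\<close> and an explicit preimage of \<open>unit_seq j\<close>
  in \<open>ell2\<close> determine the value of \<open>the_inv_into\<close>; symmetry then turns
  column \<open>j\<close> into the entries of row \<open>k\<close>.\<close>

lemma toeplitz_inv_factor:
  assumes f: "fourier_series_L2 (\<lambda>r. of_real (c r)) (\<lambda>\<omega>. of_real (f \<omega>))"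
    and bounds: "AE \<omega> in circ. m \<le> f \<omega>" "AE \<omega> in circ. f \<omega> \<le> M" "0 < m"
    and a: "fourier_series_L2 (one_sided a) g" and b: "fourier_series_L2 (one_sided b) h"
    and real: "\<And>n. cnj (a n) = a n"
    and inv: "AE \<omega> in circ. g \<omega> * h \<omega> = 1"
    and factor: "AE \<omega> in circ. f \<omega> = s * (cmod (g \<omega>))\<^sup>2" and s: "s > 0"
  shows "toeplitz_inv c k =
    (\<lambda>j. \<Sum>i\<le>k. inverse (of_real s) * b (k - i) * (if i \<le> j then b (j - i) else 0))"
proof
  fix j
  let ?w = "\<lambda>k j. \<Sum>i\<le>k. inverse (of_real s) * b (k - i) * (if i \<le> j then b (j - i) else 0)"
  have "the_inv_into ell2 (toeplitz c) (unit_seq j) = ?w j"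
  proof (rule the_inv_into_f_eq)
    show "inj_on (toeplitz c) ell2"
      by (rule toeplitz_inj_on[OF f bounds])
    show "toeplitz c (?w j) = unit_seq j"
      by (rule toeplitz_factor_column[OF f a b real inv factor s])
    show "?w j \<in> ell2"
      by (rule ell2_one_sided[OF fourier_series_L2_finite_combination[OF b]])
  qed
  then show "toeplitz_inv c k j = ?w k j"
    unfolding toeplitz_inv_def by (simp only: factor_matrix_symmetric)
qed

section \<open>Rows of the inverse, their transforms, and the entries as integrals\<close>

theorem corollary2p1:
  fixes c :: "int \<Rightarrow> real" and f :: "real \<Rightarrow> real"
    and \<sigma>2 :: real and \<psi> \<phi> :: "nat \<Rightarrow> real"
    and \<psi>F \<phi>F :: "real \<Rightarrow> complex" and \<phi>k :: "nat \<Rightarrow> real \<Rightarrow> complex"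
  assumes symmetric: "\<And>r. c (- r) = c r"
    and posdef: "positive_definite_seq c"
    and f: "fourier_series_L2 (\<lambda>r. of_real (c r)) (\<lambda>\<omega>. of_real (f \<omega>))"
    and f_lower: "0 < essinf circ (\<lambda>\<omega>. ereal (f \<omega>))"
    and f_upper: "esssup circ (\<lambda>\<omega>. ereal (f \<omega>)) < \<infinity>"
    and factorization: "spectral_factorization f \<sigma>2 \<psi> \<phi> \<psi>F \<phi>F"
    and \<phi>k: "\<And>k. fourier_series_L2
               (one_sided (\<lambda>s. if s = 0 then 0 else of_real (\<phi> (k + s)))) (\<phi>k k)"
  shows "\<forall>k. toeplitz_inv c k \<in> ell2 \<and>
     (\<exists>D. fourier_series_L2 (one_sided (toeplitz_inv c k)) D \<and>
        (AE \<omega> in circ. D \<omega> =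
           (cis (real k * \<omega>) + cnj (\<psi>F \<omega>) * cnj (\<phi>k k \<omega>)) / of_real (f \<omega>)) \<and>
        (AE \<omega> in circ. D \<omega> =
           inverse (of_real \<sigma>2) * \<phi>F \<omega> *
           (cis (real k * \<omega>) - (\<Sum>s = 1..k. of_real (\<phi> s) * cis (real (k - s) * \<omega>))))) \<and>
     (\<forall>j. toeplitz_inv c k j =
        inverse (of_real \<sigma>2) / (2 * of_real pi) *
        (LINT \<omega>:{0..2*pi}|lebesgue.
           \<phi>F \<omega> *
           (cis (real k * \<omega>) - (\<Sum>s = 1..k. of_real (\<phi> s) * cis (real (k - s) * \<omega>))) *
           cis (- (real j * \<omega>))))"
proof
  fix k
  \<comment> \<open>Both sequences include the leading coefficient 1, and \<open>b\<close> absorbs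
    the minus sign, so they are exactly the Fourier coefficients of \<open>\<psi>F\<close> and
    \<open>\<phi>F\<close>.\<close>
  define a :: "nat \<Rightarrow> complex" where "a j = (if j = 0 then 1 else of_real (\<psi> j))" for j
  define b :: "nat \<Rightarrow> complex" where "b j = (if j = 0 then 1 else - of_real (\<phi> j))" for j
  have \<sigma>2: "\<sigma>2 > 0"
    and a: "fourier_series_L2 (one_sided a) \<psi>F" and b: "fourier_series_L2 (one_sided b) \<phi>F"
    and inverse_AE: "AE \<omega> in circ. \<phi>F \<omega> = inverse (\<psi>F \<omega>)"
    and factor: "AE \<omega> in circ. f \<omega> = \<sigma>2 * (cmod (\<psi>F \<omega>))\<^sup>2"
    using factorization unfolding spectral_factorization_def a_def b_def by blast+
  obtain m where m: "0 < m" "AE \<omega> in circ. m \<le> f \<omega>"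
    using essinf_pos_AE[OF f_lower] .
  obtain M where M: "AE \<omega> in circ. f \<omega> \<le> M"
    using esssup_finite_AE[OF f_upper] .
  \<comment> \<open>A zero of \<open>\<psi>F\<close> would give \<open>f = 0\<close>, against
    \<open>m \<le> f\<close>. This is needed because \<open>inverse 0 = 0\<close> would spoil the
    product identity.\<close>
  have nonzero: "AE \<omega> in circ. \<psi>F \<omega> \<noteq> 0"
    using m(2) factor
  proof eventually_elim
    case (elim \<omega>)
    with m(1) show ?case
      by auto
  qed
  have inv: "AE \<omega> in circ. \<psi>F \<omega> * \<phi>F \<omega> = 1"
    using inverse_AE nonzero by eventually_elim simp
  let ?p = "\<lambda>\<omega>. cis (real k * \<omega>) - (\<Sum>s = 1..k. of_real (\<phi> s) * cis (real (k - s) * \<omega>))"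
  let ?D = "\<lambda>\<omega>. inverse (of_real \<sigma>2) * \<phi>F \<omega> * ?p \<omega>"
  \<comment> \<open>Reversal \<open>s = k - i\<close>: the term \<open>s = 0\<close> is
    \<open>expi (int k)\<close>, and the others carry \<open>b s = - \<phi> s\<close>.\<close>
  have p: "(\<Sum>i\<le>k. b (k - i) * expi (int i) \<omega>) = ?p \<omega>" for \<omega>
  proof -
    have "(\<Sum>i\<le>k. b (k - i) * expi (int i) \<omega>) = (\<Sum>s=0..k. b s * expi (int (k - s)) \<omega>)"
      by (rule sum.reindex_bij_witness[where i = "\<lambda>s. k - s" and j = "\<lambda>s. k - s"]) auto
    also have "\<dots> = b 0 * expi (int k) \<omega> + (\<Sum>s=1..k. b s * expi (int (k - s)) \<omega>)"
      by (subst sum.atLeast_Suc_atMost) auto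
    also have "\<dots> = ?p \<omega>"
      by (simp add: b_def sum_negf[symmetric])
    finally show ?thesis .
  qed
  have inv_row: "toeplitz_inv c k =
      (\<lambda>j. \<Sum>i\<le>k. inverse (of_real \<sigma>2) * b (k - i) * (if i \<le> j then b (j - i) else 0))"
    by (rule toeplitz_inv_factor[OF f m(2) M m(1) a b _ inv factor \<sigma>2]) (simp add: a_def)
  have "?D = (\<lambda>\<omega>. \<phi>F \<omega> * (\<Sum>i\<le>k. inverse (of_real \<sigma>2) * b (k - i) * expi (int i) \<omega>))"
    by (rule ext) (simp only: mult.assoc p mult.left_commute flip: sum_distrib_left)
  then have D: "fourier_series_L2 (one_sided (toeplitz_inv c k)) ?D"
    unfolding inv_row by (simp only: fourier_series_L2_finite_combination[OF b])
  \<comment> \<open>Splits \<open>\<phi>F\<close> into frequencies up to \<open>k\<close> and the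
    tail \<open>- \<phi>k k * expi (int k)\<close>. The shifted sequence is 0 at
    \<open>m = k\<close>, as \<open>\<phi>k\<close> starts at \<open>s = 1\<close>, so frequency
    \<open>k\<close> is counted once.\<close>
  have "fourier_series_L2 (\<lambda>r. (\<Sum>i\<le>k. b i * one_sided (\<lambda>m. if m = i then 1 else 0) r) +
      (-1) * one_sided (\<lambda>m. if k \<le> m then if m - k = 0 then 0 else of_real (\<phi> (k + (m - k))) else 0) r)
      (\<lambda>\<omega>. (\<Sum>i\<le>k. b i * expi (int i) \<omega>) + (-1) * (\<phi>k k \<omega> * expi (int k) \<omega>))"
    by (intro fourier_series_L2_add fourier_series_L2_sum fourier_series_L2_cmult fourier_series_L2_expi
        fourier_series_L2_shift[OF \<phi>k]) simp
  moreover have "(\<lambda>r. (\<Sum>i\<le>k. b i * one_sided (\<lambda>m. if m = i then 1 else 0) r) +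
      (-1) * one_sided (\<lambda>m. if k \<le> m then if m - k = 0 then 0 else of_real (\<phi> (k + (m - k))) else 0) r) =
      one_sided b"
    by (rule ext) (auto simp: one_sided_def b_def if_distrib[of "\<lambda>x. _ * x"] cong: if_cong)
  ultimately have tail: "AE \<omega> in circ. \<phi>F \<omega> =
      (\<Sum>i\<le>k. b i * expi (int i) \<omega>) + (-1) * (\<phi>k k \<omega> * expi (int k) \<omega>)"
    using fourier_series_L2_unique[OF b] by simp
  have "AE \<omega> in circ. ?D \<omega> = (cis (real k * \<omega>) + cnj (\<psi>F \<omega>) * cnj (\<phi>k k \<omega>)) / of_real (f \<omega>)"
    using tail inv factor nonzero
  proof eventually_elim
    case (elim \<omega>)
    let ?e = "expi (int k) \<omega>"
    have ee: "?e * cnj ?e = 1"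
      by (simp add: cis_cnj cis_mult)
    \<comment> \<open>Conjugating and multiplying by \<open>?e\<close> reverses the coefficients,
      which turns the head of \<open>\<phi>F\<close> into \<open>?p\<close>.\<close>
    have "?e * cnj (\<Sum>i\<le>k. b i * expi (int i) \<omega>) = (\<Sum>i\<le>k. b i * expi (int (k - i)) \<omega>)"
      unfolding cnj_sum sum_distrib_left
      by (intro sum.cong) (auto simp: b_def cis_cnj cis_mult of_nat_diff left_diff_distrib)
    also have "\<dots> = (\<Sum>i\<le>k. b (k - i) * expi (int i) \<omega>)"
      by (rule sum.reindex_bij_witness[where i = "\<lambda>s. k - s" and j = "\<lambda>s. k - s"]) auto
    finally have head: "?e * cnj (\<Sum>i\<le>k. b i * expi (int i) \<omega>) = ?p \<omega>"
      unfolding p .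
    have "?e * cnj (\<phi>F \<omega>) = ?p \<omega> - (?e * cnj ?e) * cnj (\<phi>k k \<omega>)"
      unfolding elim(1) complex_cnj_add distrib_left head by (simp add: mult_ac)
    then have cnj_\<phi>k: "cnj (\<phi>k k \<omega>) = ?p \<omega> - ?e * cnj (\<phi>F \<omega>)"
      unfolding ee by simp
    have cinv: "cnj (\<psi>F \<omega>) * cnj (\<phi>F \<omega>) = 1"
      using arg_cong[OF elim(2), of cnj] by simp
    \<comment> \<open>The conjugated tail is \<open>?p - ?e * cnj \<phi>F\<close>; multiplied by
      \<open>cnj \<psi>F\<close>, its second part becomes \<open>- ?e\<close> and cancels the
      isolated \<open>?e\<close>.\<close>
    have "?e + cnj (\<psi>F \<omega>) * cnj (\<phi>k k \<omega>) =
        ?e + cnj (\<psi>F \<omega>) * ?p \<omega> - ?e * (cnj (\<psi>F \<omega>) * cnj (\<phi>F \<omega>))"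
      unfolding cnj_\<phi>k by (simp add: right_diff_distrib mult_ac)
    also have "\<dots> = cnj (\<psi>F \<omega>) * ?p \<omega>"
      unfolding cinv by simp
    finally have num: "?e + cnj (\<psi>F \<omega>) * cnj (\<phi>k k \<omega>) = cnj (\<psi>F \<omega>) * ?p \<omega>" .
    have fe: "of_real (f \<omega>) = of_real \<sigma>2 * (\<psi>F \<omega> * cnj (\<psi>F \<omega>))"
      using elim(3) by (simp add: complex_norm_square del: of_real_power)
    have \<phi>F: "\<phi>F \<omega> = inverse (\<psi>F \<omega>)"
      using elim(2) by (metis inverse_unique)
    have "?D \<omega> = (?e + cnj (\<psi>F \<omega>) * cnj (\<phi>k k \<omega>)) / of_real (f \<omega>)"
      unfolding num fe \<phi>F using elim(4) \<sigma>2 by (simp add: divide_simps)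
    then show ?case
      by simp
  qed
  \<comment> \<open>The entry is the Fourier coefficient of \<open>?D\<close> at \<open>j\<close>,
    with the constant taken out of the integral.\<close>
  moreover have "toeplitz_inv c k j = inverse (of_real \<sigma>2) / (2 * of_real pi) *
      (LINT \<omega>:{0..2*pi}|lebesgue. \<phi>F \<omega> * ?p \<omega> * cis (- (real j * \<omega>)))" for j
  proof -
    have "(\<lambda>\<omega>. \<phi>F \<omega> * ?p \<omega> * cis (- (real j * \<omega>))) \<in> borel_measurable circ"
    proof -
      \<comment> \<open>Measurability of the integrand is inherited from \<open>?D\<close>,
        multiplied by \<open>\<sigma>2\<close> to cancel its constant.\<close>
      have "?D \<in> borel_measurable circ"
        using D by (simp only: fourier_series_L2_def square_integrable_def)
      then have "(\<lambda>\<omega>. of_real \<sigma>2 * ?D \<omega> * expi (- int j) \<omega>) \<in> borel_measurable circ"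
        by (rule borel_measurable_times[OF borel_measurable_times[OF borel_measurable_const] cis_measurable_circ])
      then show ?thesis
        using \<sigma>2 by (simp add: mult.assoc[symmetric])
    qed
    then have "inverse (of_real \<sigma>2) * (LINT \<omega>:{0..2*pi}|lebesgue. \<phi>F \<omega> * ?p \<omega> * cis (- (real j * \<omega>))) =
        (LINT \<omega>|circ. inverse (of_real \<sigma>2) * (\<phi>F \<omega> * ?p \<omega> * cis (- (real j * \<omega>))))"
      by (simp only: set_integral_circ integral_mult_right_zero)
    also have "\<dots> = (LINT \<omega>|circ. ?D \<omega> * expi (- int j) \<omega>)"
      by (simp add: mult.assoc)
    also have "\<dots> = of_real (2*pi) * toeplitz_inv c k j"
      unfolding fourier_coefficient_one_sided[OF D] by simp
    finally have eq: "inverse (of_real \<sigma>2) *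
        (LINT \<omega>:{0..2*pi}|lebesgue. \<phi>F \<omega> * ?p \<omega> * cis (- (real j * \<omega>))) =
        of_real (2*pi) * toeplitz_inv c k j" .
    have "x = r / (2 * of_real pi) * y" if "r * y = of_real (2*pi) * x" for x y r :: complex
      using that by (simp add: field_simps)
    from this[OF eq] show ?thesis .
  qed
  ultimately show "toeplitz_inv c k \<in> ell2 \<and>
     (\<exists>D. fourier_series_L2 (one_sided (toeplitz_inv c k)) D \<and>
        (AE \<omega> in circ. D \<omega> =
           (cis (real k * \<omega>) + cnj (\<psi>F \<omega>) * cnj (\<phi>k k \<omega>)) / of_real (f \<omega>)) \<and>
        (AE \<omega> in circ. D \<omega> = inverse (of_real \<sigma>2) * \<phi>F \<omega> * ?p \<omega>)) \<and>
     (\<forall>j. toeplitz_inv c k j =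
        inverse (of_real \<sigma>2) / (2 * of_real pi) *
        (LINT \<omega>:{0..2*pi}|lebesgue. \<phi>F \<omega> * ?p \<omega> * cis (- (real j * \<omega>))))"
    using D ell2_one_sided[OF D] by (intro conjI exI[of _ ?D] allI) auto
qed

end
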